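(* Let $K$ be a field (with the standing assumption on $\mathrm{char}(K)$ given in the context). For any integer $a\in\mathbb{Z}$, there exist an integer $n>0$ and a monomial ideal $I\subset S=K[x_1,\dots,x_n]$ such that $$\mathrm{reg}\,I-\mathrm{reg}\,\partial(I)=a.$$
   Context: $S=K[x_1,\dots,x_n]$ is the standard graded polynomial ring over the field $K$. For a homogeneous ideal $I\subset S$, the gradient ideal $\partial(I)$ is the ideal generated by all partial derivatives $\partial f/\partial x_i$ ($1\le i\le n$) of the elements $f$ of a minimal generating set of $I$. For a monomial ideal $I$, $\mathcal{G}(I)$ denotes its minimal monomial generating set, and $\mathrm{supp}(u)=\{i: x_i \text{ divides } u\}$ for a monomial $u$. Standing assumption: $\mathrm{char}(K)=0$, or $\mathrm{char}(K)$ is large enough that for every monomial ideal $I$ under consideration $$\partial(I)=(u/x_i:\ u\in\mathcal{G}(I),\ i\in\mathrm{supp}(u)).$$ For a homogeneous ideal $I$, $\mathrm{reg}\,I=\max\{j-i:\ \dim_K\mathrm{Tor}^S_i(K,I)_j\neq 0\}$ is the Castelnuovo–Mumford regularity of $I$. *)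

theory Defs
  imports
    Complex_Main
    "HOL-Library.Poly_Mapping"
    "HOL-Library.Function_Algebras"
    "HOL-Algebra.Ideal"
begin

section \<open>The polynomial ring \<open>S = K[x\<^sub>1, \<dots>, x\<^sub>n]\<close>\<close>

text \<open>
  A polynomial is a finitely supported map from exponent vectors to coefficients, so that
  \<^term>\<open>Poly_Mapping.single \<alpha> 1\<close> is the monomial with exponent vector \<open>\<alpha>\<close>. The indices of the
  variables are natural numbers; \<open>S\<close> consists of the polynomials that involve only the
  variables with index in \<open>{1..n}\<close>.
\<close>

type_synonym expo = "nat \<Rightarrow>\<^sub>0 nat"
type_synonym 'k mpoly = "expo \<Rightarrow>\<^sub>0 'k"

definition var_exp :: "nat \<Rightarrow> expo" where
  "var_exp k = Poly_Mapping.single k 1"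

definition expos :: "nat \<Rightarrow> expo set" where
  "expos n = {\<alpha>. Poly_Mapping.keys \<alpha> \<subseteq> {1..n}}"

definition poly_ring :: "nat \<Rightarrow> ('k::field) mpoly ring" where
  "poly_ring n =
     \<lparr>carrier = {p. Poly_Mapping.keys p \<subseteq> expos n}, mult = (*), one = 1, zero = 0, add = (+)\<rparr>"

definition mdeg :: "expo \<Rightarrow> nat" where
  "mdeg \<alpha> = (\<Sum>k\<in>Poly_Mapping.keys \<alpha>. Poly_Mapping.lookup \<alpha> k)"

definition homog :: "int \<Rightarrow> ('k::field) mpoly \<Rightarrow> bool" where
  "homog d p \<longleftrightarrow> (\<forall>\<alpha>\<in>Poly_Mapping.keys p. int (mdeg \<alpha>) = d)"

text \<open>The truncated subtraction is harmless, since the coefficient is \<open>0\<close> if \<open>x\<^sub>i\<close> does not occur.\<close>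

definition partial_deriv :: "nat \<Rightarrow> ('k::field) mpoly \<Rightarrow> 'k mpoly" where
  "partial_deriv i p = (\<Sum>\<alpha>\<in>Poly_Mapping.keys p.
     Poly_Mapping.single (\<alpha> - var_exp i) (of_nat (Poly_Mapping.lookup \<alpha> i) * Poly_Mapping.lookup p \<alpha>))"


section \<open>Monomial ideals and the gradient ideal\<close>

definition monomials :: "nat \<Rightarrow> ('k::field) mpoly set" where
  "monomials n = (\<lambda>\<alpha>. Poly_Mapping.single \<alpha> 1) ` expos n"

definition monomial_ideal :: "nat \<Rightarrow> ('k::field) mpoly set \<Rightarrow> bool" where
  "monomial_ideal n I \<longleftrightarrow> (\<exists>M\<subseteq>monomials n. I = Idl\<^bsub>poly_ring n\<^esub> M)"

definition minimal_generators :: "nat \<Rightarrow> ('k::field) mpoly set \<Rightarrow> 'k mpoly set \<Rightarrow> bool" where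
  "minimal_generators n I G \<longleftrightarrow>
     G \<subseteq> carrier (poly_ring n) \<and> Idl\<^bsub>poly_ring n\<^esub> G = I \<and> (\<forall>H\<subset>G. Idl\<^bsub>poly_ring n\<^esub> H \<noteq> I)"

text \<open>A monomial ideal has exactly one minimal generating set that consists of monomials.\<close>

definition mono_gens :: "nat \<Rightarrow> ('k::field) mpoly set \<Rightarrow> 'k mpoly set" where
  "mono_gens n I = (THE G. minimal_generators n I G \<and> G \<subseteq> monomials n)"

text \<open>
  As usual for homogeneous ideals, minimal generators are taken to be homogeneous. Without this
  the ideal would depend on the choice of \<open>G\<close> even in characteristic \<open>0\<close>: \<open>{x + x\<^sup>2, 3x - 4x\<^sup>3}\<close>
  is an irredundant generating set of \<open>(x)\<close>, but its derivatives only generate \<open>(1 + 2x)\<close>.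
\<close>

definition gradient_ideal :: "nat \<Rightarrow> ('k::field) mpoly set \<Rightarrow> 'k mpoly set" where
  "gradient_ideal n I =
     (let G = SOME G. minimal_generators n I G \<and> (\<forall>f\<in>G. \<exists>d. homog d f)
      in Idl\<^bsub>poly_ring n\<^esub> {partial_deriv i f | i f. i \<in> {1..n} \<and> f \<in> G})"

text \<open>The elements \<open>u / x\<^sub>i\<close> with \<open>u\<close> in the minimal monomial generating set and \<open>i \<in> supp(u)\<close>.\<close>

definition mono_quotients :: "nat \<Rightarrow> ('k::field) mpoly set \<Rightarrow> 'k mpoly set" where
  "mono_quotients n I =
     {Poly_Mapping.single (\<alpha> - var_exp i) 1 | \<alpha> i.
        Poly_Mapping.single \<alpha> 1 \<in> mono_gens n I \<and> i \<in> Poly_Mapping.keys \<alpha>}"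

text \<open>
  What is required of the characteristic of the field with respect to the monomial ideal \<open>I\<close>.
  It holds for all \<open>I\<close> in characteristic \<open>0\<close>, and for a given \<open>I\<close> in all large characteristics.
\<close>

definition char_suitable :: "nat \<Rightarrow> ('k::field) mpoly set \<Rightarrow> bool" where
  "char_suitable n I \<longleftrightarrow> gradient_ideal n I = Idl\<^bsub>poly_ring n\<^esub> (mono_quotients n I)"


section \<open>Graded free resolutions of \<open>K\<close>, \<open>Tor\<close> and regularity\<close>

text \<open>
  An augmented complex \<open>\<dots> \<rightarrow> P\<^sub>1 \<rightarrow> P\<^sub>0 \<rightarrow> K\<close> of graded free \<open>S\<close>-modules: \<open>P\<^sub>i\<close> has the basis
  \<open>fc_gens P i\<close>, the basis element \<open>b\<close> of \<open>P\<^sub>i\<close> has degree \<open>fc_deg P i b\<close>, the differential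
  \<open>P\<^bsub>i+1\<^esub> \<rightarrow> P\<^sub>i\<close> sends \<open>b\<close> to the sum of all \<open>fc_mat P i b b' \<cdot> b'\<close>, and the augmentation
  sends the basis element \<open>b\<close> of \<open>P\<^sub>0\<close> to \<open>fc_aug P b\<close>.
\<close>

record (overloaded) ('b, 'k::zero) free_complex =
  fc_gens :: "nat \<Rightarrow> 'b set"
  fc_deg :: "nat \<Rightarrow> 'b \<Rightarrow> int"
  fc_mat :: "nat \<Rightarrow> 'b \<Rightarrow> 'b \<Rightarrow> 'k mpoly"
  fc_aug :: "'b \<Rightarrow> 'k"

text \<open>
  The complex \<open>P \<otimes>\<^sub>S M\<close> for an ideal \<open>M\<close> of \<open>S\<close>: as \<open>P\<^sub>i\<close> is free, \<open>P\<^sub>i \<otimes> M\<close> is the direct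
  sum of copies of \<open>M\<close> indexed by the basis of \<open>P\<^sub>i\<close>, where the copy that belongs to \<open>b\<close> is
  shifted by the degree of \<open>b\<close>. For \<open>M = S\<close> this is \<open>P\<close> itself.
\<close>

definition fc_chains :: "('b, 'k::field) free_complex \<Rightarrow> 'k mpoly set \<Rightarrow> nat \<Rightarrow> ('b \<Rightarrow> 'k mpoly) set" where
  "fc_chains P M i = {c. (\<forall>b\<in>fc_gens P i. c b \<in> M) \<and> (\<forall>b. b \<notin> fc_gens P i \<longrightarrow> c b = 0)}"

definition fc_chains_deg ::
    "('b, 'k::field) free_complex \<Rightarrow> 'k mpoly set \<Rightarrow> nat \<Rightarrow> int \<Rightarrow> ('b \<Rightarrow> 'k mpoly) set" where
  "fc_chains_deg P M i j = {c\<in>fc_chains P M i. \<forall>b\<in>fc_gens P i. homog (j - fc_deg P i b) (c b)}"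

definition bd :: "('b, 'k::field) free_complex \<Rightarrow> nat \<Rightarrow> ('b \<Rightarrow> 'k mpoly) \<Rightarrow> 'b \<Rightarrow> 'k mpoly" where
  "bd P i c b' = (if b' \<in> fc_gens P i then \<Sum>b\<in>fc_gens P (Suc i). fc_mat P i b b' * c b else 0)"

definition augment :: "('b, 'k::field) free_complex \<Rightarrow> ('b \<Rightarrow> 'k mpoly) \<Rightarrow> 'k" where
  "augment P c = (\<Sum>b\<in>fc_gens P 0. fc_aug P b * Poly_Mapping.lookup (c b) 0)"

definition graded_free_resolution_of_field :: "nat \<Rightarrow> ('b, 'k::field) free_complex \<Rightarrow> bool" where
  "graded_free_resolution_of_field n P \<longleftrightarrow>
     (\<forall>i. finite (fc_gens P i)) \<and>
     (\<forall>i. \<forall>b\<in>fc_gens P (Suc i). \<forall>b'\<in>fc_gens P i.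
        fc_mat P i b b' \<in> carrier (poly_ring n) \<and>
        homog (fc_deg P (Suc i) b - fc_deg P i b') (fc_mat P i b b')) \<and>
     (\<forall>b\<in>fc_gens P 0. fc_aug P b \<noteq> 0 \<longrightarrow> fc_deg P 0 b = 0) \<and>
     (\<forall>i. {c\<in>fc_chains P (carrier (poly_ring n)) (Suc i). bd P i c = 0} =
          bd P (Suc i) ` fc_chains P (carrier (poly_ring n)) (Suc (Suc i))) \<and>
     {c\<in>fc_chains P (carrier (poly_ring n)) 0. augment P c = 0} =
       bd P 0 ` fc_chains P (carrier (poly_ring n)) (Suc 0) \<and>
     augment P ` fc_chains P (carrier (poly_ring n)) 0 = UNIV"

definition cycles_deg ::
    "('b, 'k::field) free_complex \<Rightarrow> 'k mpoly set \<Rightarrow> nat \<Rightarrow> int \<Rightarrow> ('b \<Rightarrow> 'k mpoly) set" where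
  "cycles_deg P M i j =
     {c\<in>fc_chains_deg P M i j. case i of 0 \<Rightarrow> True | Suc m \<Rightarrow> bd P m c = 0}"

definition boundaries_deg ::
    "('b, 'k::field) free_complex \<Rightarrow> 'k mpoly set \<Rightarrow> nat \<Rightarrow> int \<Rightarrow> ('b \<Rightarrow> 'k mpoly) set" where
  "boundaries_deg P M i j = bd P i ` fc_chains_deg P M (Suc i) j"

definition chain_scale :: "'k::field \<Rightarrow> ('b \<Rightarrow> 'k mpoly) \<Rightarrow> 'b \<Rightarrow> 'k mpoly" where
  "chain_scale a c = (\<lambda>b. Poly_Mapping.single 0 a * c b)"

text \<open>
  The dimension over \<open>K\<close> of the degree \<open>j\<close> part of the \<open>i\<close>-th homology of \<open>P \<otimes>\<^sub>S M\<close>. All spaces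
  involved are finite dimensional and the boundaries are contained in the cycles, so the
  subtraction is the dimension of the quotient (see \<open>homology_dim_nonzero_iff\<close> below).
\<close>

definition homology_dim :: "('b, 'k::field) free_complex \<Rightarrow> 'k mpoly set \<Rightarrow> nat \<Rightarrow> int \<Rightarrow> nat" where
  "homology_dim P M i j =
     vector_space.dim chain_scale (cycles_deg P M i j) -
     vector_space.dim chain_scale (boundaries_deg P M i j)"

text \<open>
  The Koszul complex of \<open>x\<^sub>1, \<dots>, x\<^sub>n\<close>, with basis the subsets of \<open>{1..n}\<close> and differential
  \<open>e\<^sub>T \<mapsto> \<Sum>k\<in>T. \<plusminus>x\<^sub>k e\<^bsub>T - {k}\<^esub>\<close>. It is the graded free resolution of \<open>K\<close> from which \<open>Tor\<close> is computed
  here (see \<open>koszul_resolution\<close> below): \<open>tor_dim n M i j\<close> is \<open>dim\<^sub>K Tor\<^sub>i(K, M)\<^sub>j\<close> over \<open>S\<close>.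
\<close>

definition koszul :: "nat \<Rightarrow> (nat set, 'k::field) free_complex" where
  "koszul n = \<lparr>
     fc_gens = (\<lambda>i. {T. T \<subseteq> {1..n} \<and> card T = i}),
     fc_deg = (\<lambda>i T. int i),
     fc_mat = (\<lambda>i T T'. \<Sum>k | k \<in> T \<and> T' = T - {k}.
                 Poly_Mapping.single (var_exp k) ((-1) ^ card {l\<in>T. l < k})),
     fc_aug = (\<lambda>T. 1)\<rparr>"

definition tor_dim :: "nat \<Rightarrow> ('k::field) mpoly set \<Rightarrow> nat \<Rightarrow> int \<Rightarrow> nat" where
  "tor_dim n M i j = homology_dim (koszul n) M i j"

definition regularity :: "nat \<Rightarrow> ('k::field) mpoly set \<Rightarrow> int" where
  "regularity n M = Max {j - int i | i j. tor_dim n M i j \<noteq> 0}"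


section \<open>Justification: the Koszul complex resolves \<open>K\<close>\<close>

lemma lookup_single_times:
  fixes p :: "('k::field) mpoly"
  shows "Poly_Mapping.lookup (Poly_Mapping.single (var_exp k) a * p) \<gamma> =
    (if Poly_Mapping.lookup \<gamma> k = 0 then 0 else a * Poly_Mapping.lookup p (\<gamma> - var_exp k))"
proof -
  have p: "p = (\<Sum>\<alpha>\<in>Poly_Mapping.keys p. Poly_Mapping.single \<alpha> (Poly_Mapping.lookup p \<alpha>))"
    by (rule poly_mapping_eqI) (auto simp: lookup_sum lookup_single when_def in_keys_iff)
  have eq: "var_exp k + \<alpha> = \<gamma> \<longleftrightarrow> Poly_Mapping.lookup \<gamma> k \<noteq> 0 \<and> \<alpha> = \<gamma> - var_exp k" for \<alpha>
  proof
    assume "var_exp k + \<alpha> = \<gamma>"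
    then show "Poly_Mapping.lookup \<gamma> k \<noteq> 0 \<and> \<alpha> = \<gamma> - var_exp k"
      by (auto simp: lookup_add var_exp_def)
  next
    assume A: "Poly_Mapping.lookup \<gamma> k \<noteq> 0 \<and> \<alpha> = \<gamma> - var_exp k"
    show "var_exp k + \<alpha> = \<gamma>"
      by (rule poly_mapping_eqI) (use A in \<open>auto simp: lookup_add lookup_minus var_exp_def lookup_single when_def\<close>)
  qed
  have "Poly_Mapping.single (var_exp k) a * p = (\<Sum>\<alpha>\<in>Poly_Mapping.keys p. Poly_Mapping.single (var_exp k + \<alpha>) (a * Poly_Mapping.lookup p \<alpha>))"
    (is "_ = ?s")
  proof -
    have "Poly_Mapping.single (var_exp k) a * p = Poly_Mapping.single (var_exp k) a *
        (\<Sum>\<alpha>\<in>Poly_Mapping.keys p. Poly_Mapping.single \<alpha> (Poly_Mapping.lookup p \<alpha>))"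
      by (rule arg_cong[OF p])
    also have "\<dots> = ?s" by (simp add: sum_distrib_left mult_single)
    finally show ?thesis .
  qed
  then have "Poly_Mapping.lookup (Poly_Mapping.single (var_exp k) a * p) \<gamma> =
     (\<Sum>\<alpha>\<in>Poly_Mapping.keys p. (a * Poly_Mapping.lookup p \<alpha> when var_exp k + \<alpha> = \<gamma>))"
    by (simp add: lookup_sum lookup_single)
  also have "\<dots> = (\<Sum>\<alpha>\<in>Poly_Mapping.keys p. if \<alpha> = \<gamma> - var_exp k then (if Poly_Mapping.lookup \<gamma> k \<noteq> 0 then a * Poly_Mapping.lookup p \<alpha> else 0) else 0)"
    by (rule sum.cong) (auto simp: eq when_def)
  also have "\<dots> = (if Poly_Mapping.lookup \<gamma> k = 0 then 0 else a * Poly_Mapping.lookup p (\<gamma> - var_exp k))"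
    by (simp add: sum.delta' sum.delta in_keys_iff)
  finally show ?thesis .
qed

lemma expos_add: "\<alpha> \<in> expos n \<Longrightarrow> \<beta> \<in> expos n \<Longrightarrow> \<alpha> + \<beta> \<in> expos n"
  using Poly_Mapping.keys_add[of \<alpha> \<beta>] by (auto simp: expos_def)

lemma poly_ring_carrier_iff: "p \<in> carrier (poly_ring n) \<longleftrightarrow> Poly_Mapping.keys p \<subseteq> expos n"
  by (simp add: poly_ring_def)

lemma poly_ring_simps [simp]:
  "mult (poly_ring n) = (*)" "one (poly_ring n) = 1" "zero (poly_ring n) = 0" "add (poly_ring n) = (+)"
  by (simp_all add: poly_ring_def)

lemma poly_ring_closed:
  "p \<in> carrier (poly_ring n) \<Longrightarrow> q \<in> carrier (poly_ring n) \<Longrightarrow> p + q \<in> carrier (poly_ring n)"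
  "p \<in> carrier (poly_ring n) \<Longrightarrow> q \<in> carrier (poly_ring n) \<Longrightarrow> p * q \<in> carrier (poly_ring n)"
  "p \<in> carrier (poly_ring n) \<Longrightarrow> - p \<in> carrier (poly_ring n)"
  "0 \<in> carrier (poly_ring n)" "1 \<in> carrier (poly_ring n)"
proof -
  assume "p \<in> carrier (poly_ring n)" "q \<in> carrier (poly_ring n)"
  then show "p + q \<in> carrier (poly_ring n)"
    using Poly_Mapping.keys_add[of p q] by (auto simp: poly_ring_carrier_iff)
next
  assume "p \<in> carrier (poly_ring n)" "q \<in> carrier (poly_ring n)"
  then show "p * q \<in> carrier (poly_ring n)"
    using Poly_Mapping.keys_mult[of p q] by (fastforce simp: poly_ring_carrier_iff intro: expos_add)
next
  assume "p \<in> carrier (poly_ring n)"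
  then show "- p \<in> carrier (poly_ring n)" by (auto simp: poly_ring_carrier_iff in_keys_iff subset_iff)
qed (auto simp: poly_ring_carrier_iff expos_def)

lemma poly_ring_cring: "cring (poly_ring n :: ('k::field) mpoly ring)"
proof (rule cringI)
  show "abelian_group (poly_ring n :: 'k mpoly ring)"
  proof (rule abelian_groupI)
    fix x :: "'k mpoly" assume "x \<in> carrier (poly_ring n)"
    then show "\<exists>y\<in>carrier (poly_ring n). y \<oplus>\<^bsub>poly_ring n\<^esub> x = \<zero>\<^bsub>poly_ring n\<^esub>"
      by (intro bexI[of _ "-x"]) (auto intro: poly_ring_closed)
  qed (auto intro: poly_ring_closed simp: algebra_simps)
  show "Group.comm_monoid (poly_ring n :: 'k mpoly ring)"
    by (rule comm_monoidI) (auto intro: poly_ring_closed simp: algebra_simps)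
qed (auto intro: poly_ring_closed simp: algebra_simps)
definition ksets :: "nat \<Rightarrow> nat \<Rightarrow> nat set set" where
  "ksets n i = {T. T \<subseteq> {1..n} \<and> card T = i}"

lemma fc_gens_koszul [simp]: "fc_gens (koszul n) i = ksets n i"
  by (simp add: koszul_def ksets_def)

lemma finite_ksets [simp]: "finite (ksets n i)"
proof -
  have "ksets n i \<subseteq> Pow {1..n}" by (auto simp: ksets_def)
  then show ?thesis by (rule finite_subset) simp
qed

lemma bd_koszul:
  assumes "T \<in> ksets n i"
  shows "bd (koszul n) i c T = (\<Sum>k\<in>{1..n} - T.
           Poly_Mapping.single (var_exp k) ((-1) ^ card {l\<in>T. l < k}) * c (insert k T))"
proof -
  let ?A = "\<lambda>U. {k. k \<in> U \<and> T = U - {k}}"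
  let ?m = "\<lambda>k U. Poly_Mapping.single (var_exp k) ((-1) ^ card {l\<in>U. l < k})"
  have fT: "finite T" and T: "T \<subseteq> {1..n}" "card T = i"
    using assms finite_subset[of T "{1..n}"] by (auto simp: ksets_def)
  have fin: "finite (?A U)" if "U \<in> ksets n (Suc i)" for U
  proof -
    have "finite U" using that finite_subset[of U "{1..n}"] by (auto simp: ksets_def)
    then show ?thesis by (rule finite_subset[rotated]) auto
  qed
  have "bd (koszul n) i c T = (\<Sum>U\<in>ksets n (Suc i). fc_mat (koszul n) i U T * c U)"
    using assms by (simp add: bd_def)
  also have "\<dots> = (\<Sum>U\<in>ksets n (Suc i). \<Sum>k\<in>?A U. ?m k U * c U)"
    by (rule sum.cong) (simp_all add: koszul_def sum_distrib_right)
  also have "\<dots> = (\<Sum>(U, k)\<in>Sigma (ksets n (Suc i)) ?A. ?m k U * c U)"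
    by (rule sum.Sigma) (use fin in auto)
  also have "\<dots> = (\<Sum>k\<in>{1..n} - T. ?m k (insert k T) * c (insert k T))"
  proof -
    have "Sigma (ksets n (Suc i)) ?A = (\<lambda>k. (insert k T, k)) ` ({1..n} - T)" (is "?L = ?R")
    proof
      show "?L \<subseteq> ?R"
      proof (rule subsetI)
        fix x assume "x \<in> ?L"
        moreover obtain U k where x: "x = (U, k)" by (cases x)
        ultimately have U: "U \<subseteq> {1..n}" and k: "k \<in> U" and eq: "T = U - {k}"
          by (simp_all add: ksets_def)
        have "U = insert k T" using k unfolding eq by (simp only: insert_Diff)
        moreover have "k \<in> {1..n} - T" using subsetD[OF U k] unfolding eq by simp
        ultimately show "x \<in> ?R" unfolding x image_iff by (intro bexI[of _ k]) simp_all
      qed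
      show "?R \<subseteq> ?L"
      proof (rule subsetI)
        fix x assume "x \<in> ?R"
        then obtain k where x: "x = (insert k T, k)" and k: "k \<in> {1..n}" "k \<notin> T" by (elim imageE DiffE)
        have "insert k T \<in> ksets n (Suc i)" using k T fT by (simp add: ksets_def)
        moreover have "T = insert k T - {k}" using k by blast
        ultimately show "x \<in> ?L" unfolding x by (intro SigmaI) simp_all
      qed
    qed
    moreover have "inj_on (\<lambda>k. (insert k T, k)) ({1..n} - T)" by (rule inj_onI) simp
    ultimately show ?thesis by (simp add: sum.reindex)
  qed
  also have "\<dots> = (\<Sum>k\<in>{1..n} - T. ?m k T * c (insert k T))"
  proof (rule sum.cong)
    fix k
    have "{l \<in> insert k T. l < k} = {l\<in>T. l < k}" by auto
    then show "?m k (insert k T) * c (insert k T) = ?m k T * c (insert k T)" by simp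
  qed simp
  finally show ?thesis .
qed

lemma lookup_bd_koszul:
  assumes "T \<in> ksets n i"
  shows "Poly_Mapping.lookup (bd (koszul n) i c T) \<beta> = (\<Sum>k\<in>{1..n} - T.
           if Poly_Mapping.lookup \<beta> k = 0 then 0
           else (-1) ^ card {l\<in>T. l < k} * Poly_Mapping.lookup (c (insert k T)) (\<beta> - var_exp k))"
  by (simp add: bd_koszul[OF assms] lookup_sum lookup_single_times)

lemma koszul_mat_closed: "fc_mat (koszul n) i U T \<in> carrier (poly_ring n)" if "U \<subseteq> {1..n}"
proof -
  have "Poly_Mapping.single (var_exp k) a \<in> carrier (poly_ring n)" if "k \<in> U" for k a
    using that \<open>U \<subseteq> {1..n}\<close> by (auto simp: poly_ring_carrier_iff expos_def var_exp_def split: if_splits)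
  then have "sum (\<lambda>k. Poly_Mapping.single (var_exp k) (f k)) A \<in> carrier (poly_ring n)" if "A \<subseteq> U" for f A
    using that by (induction A rule: infinite_finite_induct) (auto intro: poly_ring_closed)
  from this[of "{k. k \<in> U \<and> T = U - {k}}"] show ?thesis by (auto simp: koszul_def)
qed

lemma bd_koszul_closed:
  fixes c :: "nat set \<Rightarrow> ('k::field) mpoly"
  assumes "c \<in> fc_chains (koszul n) (carrier (poly_ring n)) (Suc i)"
  shows "bd (koszul n) i c \<in> fc_chains (koszul n) (carrier (poly_ring n)) i"
proof -
  have "sum f A \<in> carrier (poly_ring n)" if "\<And>x. x \<in> A \<Longrightarrow> f x \<in> carrier (poly_ring n)"
    for f :: "nat set \<Rightarrow> 'k mpoly" and A
    using that by (induction A rule: infinite_finite_induct) (auto intro: poly_ring_closed)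
  note sum = this
  have "fc_mat (koszul n) i U T * c U \<in> carrier (poly_ring n)" if "U \<in> ksets n (Suc i)" for U T
    using that assms by (intro poly_ring_closed(2) koszul_mat_closed) (auto simp: fc_chains_def ksets_def)
  then have "bd (koszul n) i c T \<in> carrier (poly_ring n)" for T
    unfolding bd_def by (auto intro: sum poly_ring_closed(4))
  then show ?thesis by (simp add: fc_chains_def) (simp add: bd_def)
qed

lemma bd_koszul_bd:
  "bd (koszul n) i (bd (koszul n) (Suc i) c) = (0 :: nat set \<Rightarrow> ('k::field) mpoly)"
proof
  fix T :: "nat set"
  show "bd (koszul n) i (bd (koszul n) (Suc i) c) T = 0 T"
  proof (cases "T \<in> ksets n i")
    case False
    then show ?thesis by (simp add: bd_def)
  next
    case True
    define N where "N = {1..n} - T"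
    define s where "s k U = (Poly_Mapping.single (var_exp k) ((-1) ^ card {l\<in>U. l < k}) :: 'k mpoly)" for k U
    define f where "f k l = s k T * (s l (insert k T) * c (insert l (insert k T)))" for k l
    have fT: "finite T" and T: "T \<subseteq> {1..n}" "card T = i"
      using True finite_subset[of T "{1..n}"] by (auto simp: ksets_def)
    have fN: "finite N" by (simp add: N_def)
    have "bd (koszul n) i (bd (koszul n) (Suc i) c) T =
        (\<Sum>k\<in>N. s k T * bd (koszul n) (Suc i) c (insert k T))"
      by (simp add: bd_koszul[OF True] N_def s_def)
    also have "\<dots> = (\<Sum>k\<in>N. \<Sum>l\<in>N - {k}. f k l)"
    proof (rule sum.cong)
      fix k assume k: "k \<in> N"
      then have "insert k T \<in> ksets n (Suc i)" using T fT by (auto simp: ksets_def N_def)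
      moreover have "{1..n} - insert k T = N - {k}" by (auto simp: N_def)
      ultimately have "bd (koszul n) (Suc i) c (insert k T) = (\<Sum>l\<in>N - {k}. s l (insert k T) * c (insert l (insert k T)))"
        by (simp only: bd_koszul s_def)
      then show "s k T * bd (koszul n) (Suc i) c (insert k T) = (\<Sum>l\<in>N - {k}. f k l)"
        by (simp add: f_def sum_distrib_left)
    qed simp
    also have "\<dots> = (\<Sum>(k, l)\<in>Sigma N (\<lambda>k. N - {k}). f k l)"
      by (rule sum.Sigma) (use fN in auto)
    also have "Sigma N (\<lambda>k. N - {k}) = {(k, l) \<in> N \<times> N. k < l} \<union> {(k, l) \<in> N \<times> N. l < k}"
      by auto
    also have "(\<Sum>(k, l)\<in>{(k, l) \<in> N \<times> N. k < l} \<union> {(k, l) \<in> N \<times> N. l < k}. f k l) =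
        (\<Sum>(k, l)\<in>{(k, l) \<in> N \<times> N. k < l}. f k l) + (\<Sum>(k, l)\<in>{(k, l) \<in> N \<times> N. l < k}. f k l)"
      by (rule sum.union_disjoint) (auto intro: finite_subset[of _ "N \<times> N"] simp: fN)
    also have "(\<Sum>(k, l)\<in>{(k, l) \<in> N \<times> N. l < k}. f k l) = (\<Sum>(k, l)\<in>{(k, l) \<in> N \<times> N. k < l}. f l k)"
      by (rule sum.reindex_bij_witness[where i = prod.swap and j = prod.swap]) auto
    also have "(\<Sum>(k, l)\<in>{(k, l) \<in> N \<times> N. k < l}. f l k) = (\<Sum>(k, l)\<in>{(k, l) \<in> N \<times> N. k < l}. - f k l)"
    proof (rule sum.cong, simp, clarify)
      fix k l assume kl: "k \<in> N" "l \<in> N" "k < l"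
      have "{j \<in> insert k T. j < l} = insert k {j \<in> T. j < l}" using kl by auto
      then have "card {j \<in> insert k T. j < l} = Suc (card {j \<in> T. j < l})"
        using kl fT by (simp add: N_def)
      then have 1: "s l (insert k T) = - s l T" by (simp add: s_def single_uminus)
      have "{j \<in> insert l T. j < k} = {j \<in> T. j < k}" using kl by auto
      then have 2: "s k (insert l T) = s k T" by (simp add: s_def)
      show "f l k = - f k l" by (simp add: f_def 1 2 insert_commute algebra_simps)
    qed
    also have "(\<Sum>(k, l)\<in>{(k, l) \<in> N \<times> N. k < l}. f k l) + (\<Sum>(k, l)\<in>{(k, l) \<in> N \<times> N. k < l}. - f k l) = 0"
      by (simp add: sum.distrib[symmetric] case_prod_unfold)
    finally show ?thesis by simp
  qed
qed

text \<open>
  The Koszul complex is multigraded, the multidegree of \<open>x\<^sup>\<beta> e\<^sub>T\<close> having support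
  \<open>keys \<beta> \<union> T\<close>. In each nonzero multidegree, multiplication by \<open>e\<^sub>k / x\<^sub>k\<close> for the least \<open>k\<close> in
  the support is a contracting homotopy, in any characteristic.
\<close>

definition koszul_homotopy ::
    "nat \<Rightarrow> nat \<Rightarrow> (nat set \<Rightarrow> ('k::field) mpoly) \<Rightarrow> nat set \<Rightarrow> 'k mpoly" where
  "koszul_homotopy n i z U =
     (if U \<in> ksets n (Suc i) then
        \<Sum>\<gamma>\<in>{\<gamma>\<in>Poly_Mapping.keys (z (U - {Min U})).
              Poly_Mapping.lookup \<gamma> (Min U) \<noteq> 0 \<and> (\<forall>l\<in>Poly_Mapping.keys \<gamma>. Min U \<le> l)}.
          Poly_Mapping.single (\<gamma> - var_exp (Min U)) (Poly_Mapping.lookup (z (U - {Min U})) \<gamma>)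
      else 0)"

lemma lookup_var_exp: "Poly_Mapping.lookup (var_exp k) l = (if k = l then 1 else 0)"
  by (simp add: var_exp_def lookup_single when_def)

lemma exp_minus_var_eq: "Poly_Mapping.lookup \<gamma> k \<noteq> 0 \<Longrightarrow> \<gamma> - var_exp k = \<beta> \<longleftrightarrow> \<gamma> = \<beta> + var_exp k"
  by (auto simp: poly_mapping_eq_iff fun_eq_iff lookup_add lookup_minus lookup_var_exp)

lemma keys_add_var: "Poly_Mapping.keys (\<beta> + var_exp k) = insert k (Poly_Mapping.keys \<beta>)"
  by (auto simp: in_keys_iff lookup_add var_exp_def lookup_single when_def split: if_splits)

lemma lookup_koszul_homotopy:
  fixes z :: "nat set \<Rightarrow> ('k::field) mpoly"
  assumes "U \<in> ksets n (Suc i)"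
  shows "Poly_Mapping.lookup (koszul_homotopy n i z U) \<beta> =
    (if \<forall>l\<in>Poly_Mapping.keys \<beta>. Min U \<le> l then Poly_Mapping.lookup (z (U - {Min U})) (\<beta> + var_exp (Min U)) else 0)"
proof -
  let ?k = "Min U"
  let ?A = "{\<gamma>\<in>Poly_Mapping.keys (z (U - {?k})). Poly_Mapping.lookup \<gamma> ?k \<noteq> 0 \<and> (\<forall>l\<in>Poly_Mapping.keys \<gamma>. ?k \<le> l)}"
  have "Poly_Mapping.lookup (koszul_homotopy n i z U) \<beta> =
      (\<Sum>\<gamma>\<in>?A. Poly_Mapping.lookup (z (U - {?k})) \<gamma> when \<gamma> - var_exp ?k = \<beta>)"
    using assms by (simp add: koszul_homotopy_def lookup_sum lookup_single)
  also have "\<dots> = (\<Sum>\<gamma>\<in>?A. if \<gamma> = \<beta> + var_exp ?k then Poly_Mapping.lookup (z (U - {?k})) \<gamma> else 0)"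
    by (rule sum.cong) (auto simp: exp_minus_var_eq when_def)
  also have "\<dots> = (if \<beta> + var_exp ?k \<in> ?A then Poly_Mapping.lookup (z (U - {?k})) (\<beta> + var_exp ?k) else 0)"
    by (rule sum.delta) simp
  also have "\<beta> + var_exp ?k \<in> ?A \<longleftrightarrow> Poly_Mapping.lookup (z (U - {?k})) (\<beta> + var_exp ?k) \<noteq> 0 \<and> (\<forall>l\<in>Poly_Mapping.keys \<beta>. ?k \<le> l)"
    by (auto simp: keys_add_var in_keys_iff[of "\<beta> + var_exp ?k"] lookup_add lookup_var_exp)
  finally show ?thesis by auto
qed

lemma koszul_homotopy_closed:
  fixes z :: "nat set \<Rightarrow> ('k::field) mpoly"
  assumes "z \<in> fc_chains (koszul n) (carrier (poly_ring n)) i"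
  shows "koszul_homotopy n i z \<in> fc_chains (koszul n) (carrier (poly_ring n)) (Suc i)"
proof -
  have "koszul_homotopy n i z U \<in> carrier (poly_ring n)"
    if U: "U \<in> ksets n (Suc i)" for U
    unfolding poly_ring_carrier_iff
  proof
    fix \<beta> assume "\<beta> \<in> Poly_Mapping.keys (koszul_homotopy n i z U)"
    then have "Poly_Mapping.lookup (koszul_homotopy n i z U) \<beta> \<noteq> 0" by (simp add: in_keys_iff)
    then have nz: "Poly_Mapping.lookup (z (U - {Min U})) (\<beta> + var_exp (Min U)) \<noteq> 0"
      by (auto simp: lookup_koszul_homotopy[OF U] split: if_splits)
    then have "z (U - {Min U}) \<noteq> 0" by auto
    then have "z (U - {Min U}) \<in> carrier (poly_ring n)"
      using assms by (auto simp: fc_chains_def)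
    then have "\<beta> + var_exp (Min U) \<in> expos n" using nz by (auto simp: poly_ring_carrier_iff in_keys_iff)
    then show "\<beta> \<in> expos n" by (simp add: expos_def keys_add_var)
  qed
  moreover have "koszul_homotopy n i z U = 0"
    if U: "U \<notin> ksets n (Suc i)" for U
    using U by (simp add: koszul_homotopy_def)
  ultimately show ?thesis by (auto simp: fc_chains_def)
qed

lemma bd_koszul_homotopy:
  fixes z :: "nat set \<Rightarrow> ('k::field) mpoly"
  assumes z: "z \<in> fc_chains (koszul n) (carrier (poly_ring n)) i"
    and zero: "i = 0 \<Longrightarrow> Poly_Mapping.lookup (z {}) 0 = 0"
    and cyc: "\<And>m. i = Suc m \<Longrightarrow> bd (koszul n) m z = 0"
  shows "bd (koszul n) i (koszul_homotopy n i z) = z"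
proof
  fix T
  let ?P = "koszul n :: (nat set, 'k) free_complex"
  let ?h = "koszul_homotopy n i z"
  let ?y = "bd ?P i ?h"
  have y: "?y \<in> fc_chains ?P (carrier (poly_ring n)) i"
    by (intro bd_koszul_closed koszul_homotopy_closed z)
  show "?y T = z T"
  proof (cases "T \<in> ksets n i")
    case False
    then have "?y T = 0" "z T = 0" using y z unfolding fc_chains_def by auto
    then show ?thesis by simp
  next
    case T: True
    have fT: "finite T" and T': "T \<subseteq> {1..n}" "card T = i"
      using T finite_subset[of T "{1..n}"] by (auto simp: ksets_def)
    show ?thesis
    proof (rule poly_mapping_eqI)
      fix \<beta>
      define t where "t k = (if Poly_Mapping.lookup \<beta> k = 0 then 0 else (-1) ^ card {l\<in>T. l < k} * Poly_Mapping.lookup (?h (insert k T)) (\<beta> - var_exp k))" for k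
      have y_eq: "Poly_Mapping.lookup (?y T) \<beta> = sum t ({1..n} - T)"
        by (simp add: lookup_bd_koszul[OF T] t_def)
      have ins: "insert k T \<in> ksets n (Suc i)" if "k \<in> {1..n} - T" for k
        using that T' fT by (auto simp: ksets_def)
      consider "\<beta> \<notin> expos n" | "T = {}" "\<beta> = 0" | "\<beta> \<in> expos n" "T \<union> Poly_Mapping.keys \<beta> \<noteq> {}"
        by auto
      then show "Poly_Mapping.lookup (?y T) \<beta> = Poly_Mapping.lookup (z T) \<beta>"
      proof cases
        case 1
        then have "\<beta> \<notin> Poly_Mapping.keys p" if "p \<in> carrier (poly_ring n)" for p :: "'k mpoly"
          using that by (auto simp: poly_ring_carrier_iff)
        moreover have "?y T \<in> carrier (poly_ring n)" "z T \<in> carrier (poly_ring n)"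
          using y z T by (auto simp: fc_chains_def)
        ultimately show ?thesis by (simp add: in_keys_iff)
      next
        case 2
        then have "i = 0" using T' by simp
        then show ?thesis unfolding y_eq using 2 zero by (simp add: t_def)
      next
        case 3
        define k0 where "k0 = Min (T \<union> Poly_Mapping.keys \<beta>)"
        have k0: "k0 \<in> T \<union> Poly_Mapping.keys \<beta>" "\<And>l. l \<in> T \<union> Poly_Mapping.keys \<beta> \<Longrightarrow> k0 \<le> l"
          using 3 fT unfolding k0_def by (auto intro!: Min_in simp del: Un_iff)
        have k0n: "k0 \<in> {1..n}" using k0(1) T' 3 by (auto simp: expos_def)
        show ?thesis
        proof (cases "k0 \<in> T")
          case False
          then have b0: "Poly_Mapping.lookup \<beta> k0 \<noteq> 0" using k0 by (auto simp: in_keys_iff)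
          have "t k = 0" if k: "k \<in> {1..n} - T - {k0}" for k
          proof (cases "Poly_Mapping.lookup \<beta> k = 0")
            case nz: False
            have "Min (insert k T) \<in> insert k T" using fT by (intro Min_in) auto
            then have "Min (insert k T) \<noteq> k0" "k0 \<le> Min (insert k T)"
              using k False k0(2) nz by (auto simp: in_keys_iff)
            moreover have "k0 \<in> Poly_Mapping.keys (\<beta> - var_exp k)"
              using k b0 by (auto simp: in_keys_iff lookup_minus var_exp_def lookup_single)
            ultimately have "\<not> (\<forall>l\<in>Poly_Mapping.keys (\<beta> - var_exp k). Min (insert k T) \<le> l)" by force
            then show ?thesis using k ins by (auto simp: t_def lookup_koszul_homotopy)
          qed (simp add: t_def)
          then have "sum t ({1..n} - T) = sum t {k0}"
            by (intro sum.mono_neutral_right) (use k0n False in auto)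
          also have "\<dots> = Poly_Mapping.lookup (z T) \<beta>"
          proof -
            have m: "Min (insert k0 T) = k0" using fT k0(2) by (intro Min_eqI) auto
            have c: "{l\<in>T. l < k0} = {}" using k0(2) by force
            have a: "\<beta> - var_exp k0 + var_exp k0 = \<beta>" using exp_minus_var_eq[OF b0] by metis
            have "\<forall>l\<in>Poly_Mapping.keys (\<beta> - var_exp k0). k0 \<le> l"
              using k0(2) by (auto simp: in_keys_iff lookup_minus)
            then show ?thesis
              using b0 False k0n by (simp add: t_def c lookup_koszul_homotopy[OF ins] m a)
          qed
          finally show ?thesis by (simp add: y_eq)
        next
          case True
          then obtain m where m: "i = Suc m" using T' fT by (cases i) auto
          define T0 where "T0 = T - {k0}"
          define \<beta>' where "\<beta>' = \<beta> + var_exp k0"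
          define r where "r k = (if Poly_Mapping.lookup \<beta>' k = 0 then 0 else (-1) ^ card {l\<in>T0. l < k} * Poly_Mapping.lookup (z (insert k T0)) (\<beta>' - var_exp k))" for k
          have T0: "T0 \<in> ksets n m" using T' True fT m by (auto simp: T0_def ksets_def)
          have "0 = Poly_Mapping.lookup (bd ?P m z T0) \<beta>'" using cyc[OF m] by simp
          also have "\<dots> = sum r ({1..n} - T0)" by (simp add: lookup_bd_koszul[OF T0] r_def)
          also have "{1..n} - T0 = insert k0 ({1..n} - T)" using True k0n by (auto simp: T0_def)
          also have "sum r (insert k0 ({1..n} - T)) = r k0 + sum r ({1..n} - T)"
            using True by (subst sum.insert) auto
          also have "r k0 = Poly_Mapping.lookup (z T) \<beta>"
          proof -
            have "{l\<in>T0. l < k0} = {}" using k0(2) by (force simp: T0_def)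
            then have "card {l\<in>T0. l < k0} = 0" by (simp only: card.empty)
            moreover have "insert k0 T0 = T" using True by (auto simp: T0_def)
            moreover have "Poly_Mapping.lookup \<beta>' k0 \<noteq> 0" by (simp add: \<beta>'_def lookup_add var_exp_def)
            ultimately show ?thesis by (simp only: r_def if_False power_0 mult_1) (simp add: \<beta>'_def)
          qed
          also have "sum r ({1..n} - T) = (\<Sum>k\<in>{1..n} - T. - t k)"
          proof (rule sum.cong)
            fix k assume k: "k \<in> {1..n} - T"
            then have kk0: "k \<noteq> k0" using True by auto
            then have eq: "Poly_Mapping.lookup \<beta>' k = Poly_Mapping.lookup \<beta> k" by (simp add: \<beta>'_def lookup_add var_exp_def lookup_single)
            show "r k = - t k"
            proof (cases "Poly_Mapping.lookup \<beta> k = 0")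
              case nz: False
              then have lt: "k0 < k" using k0(2)[of k] kk0 by (auto simp: in_keys_iff)
              have mi: "Min (insert k T) = k0" using fT k0(2) True lt by (intro Min_eqI) auto
              have "\<forall>l\<in>Poly_Mapping.keys (\<beta> - var_exp k). k0 \<le> l"
                using k0(2) by (auto simp: in_keys_iff lookup_minus)
              then have h: "Poly_Mapping.lookup (?h (insert k T)) (\<beta> - var_exp k) = Poly_Mapping.lookup (z (insert k T - {k0})) (\<beta> - var_exp k + var_exp k0)"
                using ins[OF k] by (simp add: lookup_koszul_homotopy mi)
              have e1: "insert k T - {k0} = insert k T0" using kk0 by (auto simp: T0_def)
              have e2: "\<beta> - var_exp k + var_exp k0 = \<beta>' - var_exp k"
              proof (rule poly_mapping_eqI)
                fix j
                show "Poly_Mapping.lookup (\<beta> - var_exp k + var_exp k0) j = Poly_Mapping.lookup (\<beta>' - var_exp k) j"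
                  using nz by (cases "j = k") (auto simp: \<beta>'_def lookup_add lookup_minus var_exp_def lookup_single)
              qed
              have "{l\<in>T. l < k} = insert k0 {l\<in>T0. l < k}" using True lt by (auto simp: T0_def)
              then have "card {l\<in>T. l < k} = Suc (card {l\<in>T0. l < k})" using fT by (simp add: T0_def)
              then show ?thesis using nz by (simp add: r_def t_def eq h e1 e2)
            qed (simp add: r_def t_def eq)
          qed simp
          finally show ?thesis by (simp add: y_eq sum_negf)
        qed
      qed
    qed
  qed
qed

lemma koszul_gens_0: "ksets n 0 = {{}}"
  using finite_subset[of _ "{1..n}"] by (auto simp: ksets_def)

lemma augment_koszul: "augment (koszul n) c = Poly_Mapping.lookup (c {}) 0"
  by (simp add: augment_def koszul_gens_0) (simp add: koszul_def)

theorem koszul_resolution: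
  "graded_free_resolution_of_field n (koszul n :: (nat set, 'k::field) free_complex)"
proof -
  let ?P = "koszul n :: (nat set, 'k::field) free_complex"
  let ?S = "carrier (poly_ring n) :: 'k mpoly set"
  have mat: "fc_mat ?P i b b' \<in> ?S" "homog (fc_deg ?P (Suc i) b - fc_deg ?P i b') (fc_mat ?P i b b')"
    if "b \<in> ksets n (Suc i)" for i b b'
  proof -
    show "fc_mat ?P i b b' \<in> ?S" using that by (intro koszul_mat_closed) (auto simp: ksets_def)
    have "homog 1 (sum (\<lambda>k. Poly_Mapping.single (var_exp k) (f k)) A :: 'k mpoly)" for f A
      unfolding homog_def
    proof
      fix \<alpha> assume "\<alpha> \<in> Poly_Mapping.keys (sum (\<lambda>k. Poly_Mapping.single (var_exp k) (f k)) A :: 'k mpoly)"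
      then have "(\<Sum>k\<in>A. Poly_Mapping.lookup (Poly_Mapping.single (var_exp k) (f k)) \<alpha>) \<noteq> 0"
        by (simp add: in_keys_iff lookup_sum)
      then obtain k where "Poly_Mapping.lookup (Poly_Mapping.single (var_exp k) (f k)) \<alpha> \<noteq> 0"
        by (metis (no_types, lifting) sum.neutral)
      then have "\<alpha> = var_exp k" by (auto simp: lookup_single when_def split: if_splits)
      then show "int (mdeg \<alpha>) = 1" by (simp add: mdeg_def var_exp_def)
    qed
    then show "homog (fc_deg ?P (Suc i) b - fc_deg ?P i b') (fc_mat ?P i b b')"
      by (simp add: koszul_def)
  qed
  have ex: "{c\<in>fc_chains ?P ?S (Suc i). bd ?P i c = 0} = bd ?P (Suc i) ` fc_chains ?P ?S (Suc (Suc i))" for i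
  proof safe
    fix c assume "c \<in> fc_chains ?P ?S (Suc i)" "bd ?P i c = 0"
    then show "c \<in> bd ?P (Suc i) ` fc_chains ?P ?S (Suc (Suc i))"
      using bd_koszul_homotopy[of c n "Suc i"] koszul_homotopy_closed[of c n "Suc i"]
      by (metis (no_types, lifting) Suc_inject imageI nat.distinct(1))
  qed (auto simp: bd_koszul_bd intro: bd_koszul_closed)
  have ex0: "{c\<in>fc_chains ?P ?S 0. augment ?P c = 0} = bd ?P 0 ` fc_chains ?P ?S (Suc 0)"
  proof safe
    fix c assume "c \<in> fc_chains ?P ?S 0" "augment ?P c = 0"
    then show "c \<in> bd ?P 0 ` fc_chains ?P ?S (Suc 0)"
      using bd_koszul_homotopy[of c n 0] koszul_homotopy_closed[of c n 0]
      by (metis (no_types, lifting) augment_koszul imageI nat.distinct(1))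
  next
    fix c :: "nat set \<Rightarrow> 'k mpoly"
    have "{} \<in> ksets n 0" by (simp add: koszul_gens_0)
    then show "augment ?P (bd ?P 0 c) = 0" by (simp add: augment_koszul lookup_bd_koszul)
  qed (auto intro: bd_koszul_closed)
  have "a \<in> augment ?P ` fc_chains ?P ?S 0" for a
  proof
    show "a = augment ?P (\<lambda>T. if T = {} then Poly_Mapping.single 0 a else 0)"
      by (simp add: augment_koszul)
    show "(\<lambda>T. if T = {} then Poly_Mapping.single 0 a else 0) \<in> fc_chains ?P ?S 0"
      by (auto simp: fc_chains_def koszul_gens_0 poly_ring_carrier_iff expos_def)
  qed
  then have "augment ?P ` fc_chains ?P ?S 0 = UNIV" by blast
  moreover have "fc_deg ?P 0 b = 0" for b by (simp add: koszul_def)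
  ultimately show ?thesis
    unfolding graded_free_resolution_of_field_def using mat ex ex0 by simp
qed

lemma vector_space_chain_scale:
  "vector_space (chain_scale :: 'k::field \<Rightarrow> ('b \<Rightarrow> 'k mpoly) \<Rightarrow> 'b \<Rightarrow> 'k mpoly)"
proof (rule vector_space.intro)
  fix a b :: 'k and x y :: "'b \<Rightarrow> 'k mpoly"
  have "Poly_Mapping.single 0 a * (Poly_Mapping.single 0 b * x t) = Poly_Mapping.single 0 (a * b) * x t" for t
    by (simp add: mult_single flip: mult.assoc)
  then show "chain_scale a (chain_scale b x) = chain_scale (a * b) x"
    unfolding chain_scale_def by (simp only:)
qed (simp_all add: chain_scale_def fun_eq_iff distrib_left distrib_right single_add)

lemma finite_expos_mdeg: "finite {\<alpha>\<in>expos n. mdeg \<alpha> = d}"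
proof (rule inj_on_finite)
  show "inj_on Poly_Mapping.lookup {\<alpha>\<in>expos n. mdeg \<alpha> = d}"
    by (rule inj_onI) (simp only: poly_mapping_eq_iff)
  show "finite {f. \<forall>k. (k \<in> {1..n} \<longrightarrow> f k \<in> {..d}) \<and> (k \<notin> {1..n} \<longrightarrow> f k = (0::nat))}"
    by (rule finite_set_of_finite_funs) auto
  show "Poly_Mapping.lookup ` {\<alpha>\<in>expos n. mdeg \<alpha> = d} \<subseteq>
      {f. \<forall>k. (k \<in> {1..n} \<longrightarrow> f k \<in> {..d}) \<and> (k \<notin> {1..n} \<longrightarrow> f k = 0)}"
  proof clarify
    fix \<alpha> k assume \<alpha>: "\<alpha> \<in> expos n"
    have "Poly_Mapping.lookup \<alpha> k \<le> mdeg \<alpha>"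
    proof (cases "k \<in> Poly_Mapping.keys \<alpha>")
      case True
      then show ?thesis unfolding mdeg_def by (intro member_le_sum) auto
    qed (simp add: in_keys_iff)
    then show "(k \<in> {1..n} \<longrightarrow> Poly_Mapping.lookup \<alpha> k \<in> {..mdeg \<alpha>}) \<and> (k \<notin> {1..n} \<longrightarrow> Poly_Mapping.lookup \<alpha> k = 0)"
      using \<alpha> by (auto simp: expos_def in_keys_iff subset_iff)
  qed
qed

lemma chains_deg_finite_span:
  fixes P :: "('b, 'k::field) free_complex"
  assumes fin: "finite (fc_gens P i)" and M: "M \<subseteq> carrier (poly_ring n)"
  shows "\<exists>W. finite W \<and> fc_chains_deg P M i j \<subseteq> module.span chain_scale W"
proof -
  interpret vs: vector_space "chain_scale :: 'k \<Rightarrow> ('b \<Rightarrow> 'k mpoly) \<Rightarrow> 'b \<Rightarrow> 'k mpoly"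
    by (rule vector_space_chain_scale)
  define E where "E b = {\<alpha>\<in>expos n. mdeg \<alpha> = nat (j - fc_deg P i b)}" for b
  define w where "w b \<alpha> = (\<lambda>b'. if b' = b then Poly_Mapping.single \<alpha> 1 else 0 :: 'k mpoly)" for b :: 'b and \<alpha>
  define W where "W = (\<Union>b\<in>fc_gens P i. w b ` E b)"
  have "finite W" unfolding W_def E_def using fin by (intro finite_UN_I finite_imageI finite_expos_mdeg)
  moreover have "c \<in> vs.span W" if c: "c \<in> fc_chains_deg P M i j" for c
  proof -
    have keys: "Poly_Mapping.keys (c b) \<subseteq> E b" if "b \<in> fc_gens P i" for b
    proof -
      have "c b \<in> carrier (poly_ring n)" "homog (j - fc_deg P i b) (c b)"
        using c that M by (auto simp: fc_chains_deg_def fc_chains_def)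
      then show ?thesis by (force simp: poly_ring_carrier_iff homog_def E_def)
    qed
    have ap: "sum f A x = (\<Sum>y\<in>A. f y x)" for f :: "'c \<Rightarrow> 'b \<Rightarrow> 'k mpoly" and A x
      by (induction A rule: infinite_finite_induct) auto
    have p: "(\<Sum>\<alpha>\<in>Poly_Mapping.keys p. Poly_Mapping.single \<alpha> (Poly_Mapping.lookup p \<alpha>)) = p" for p :: "'k mpoly"
      by (rule poly_mapping_eqI) (auto simp: lookup_sum lookup_single when_def in_keys_iff)
    have "c = (\<Sum>b\<in>fc_gens P i. \<Sum>\<alpha>\<in>Poly_Mapping.keys (c b). chain_scale (Poly_Mapping.lookup (c b) \<alpha>) (w b \<alpha>))"
    proof
      fix x
      have "(\<Sum>b\<in>fc_gens P i. \<Sum>\<alpha>\<in>Poly_Mapping.keys (c b). chain_scale (Poly_Mapping.lookup (c b) \<alpha>) (w b \<alpha>)) x =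
         (\<Sum>b\<in>fc_gens P i. \<Sum>\<alpha>\<in>Poly_Mapping.keys (c b). chain_scale (Poly_Mapping.lookup (c b) \<alpha>) (w b \<alpha>) x)"
        by (simp only: ap)
      also have "\<dots> = (\<Sum>b\<in>fc_gens P i. if b = x then c b else 0)"
        by (rule sum.cong) (auto simp: chain_scale_def w_def mult_single p)
      also have "\<dots> = c x"
        using fin c by (auto simp: sum.delta fc_chains_deg_def fc_chains_def)
      finally show "c x = (\<Sum>b\<in>fc_gens P i. \<Sum>\<alpha>\<in>Poly_Mapping.keys (c b). chain_scale (Poly_Mapping.lookup (c b) \<alpha>) (w b \<alpha>)) x"
        by simp
    qed
    also have "\<dots> \<in> vs.span W"
      using keys by (intro vs.span_sum vs.span_scale vs.span_base) (auto simp: W_def)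
    finally show ?thesis .
  qed
  ultimately show ?thesis by blast
qed

lemma homog_closed:
  "homog d 0" "homog d p \<Longrightarrow> homog d q \<Longrightarrow> homog d (p + q)"
  "homog d p \<Longrightarrow> homog d (Poly_Mapping.single 0 a * p)"
proof -
  show "homog d p \<Longrightarrow> homog d q \<Longrightarrow> homog d (p + q)"
    using Poly_Mapping.keys_add[of p q] unfolding homog_def by blast
  show "homog d p \<Longrightarrow> homog d (Poly_Mapping.single 0 a * p)"
  proof -
    assume p: "homog d p"
    have "Poly_Mapping.keys (Poly_Mapping.single 0 a * p) \<subseteq> Poly_Mapping.keys p"
    proof
      fix \<alpha> assume "\<alpha> \<in> Poly_Mapping.keys (Poly_Mapping.single 0 a * p)"
      then obtain \<beta> \<gamma> where "\<alpha> = \<beta> + \<gamma>" "\<beta> \<in> Poly_Mapping.keys (Poly_Mapping.single (0::expo) a)"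
        "\<gamma> \<in> Poly_Mapping.keys p"
        using Poly_Mapping.keys_mult[of "Poly_Mapping.single 0 a" p] by blast
      then show "\<alpha> \<in> Poly_Mapping.keys p" by (simp split: if_splits)
    qed
    then show ?thesis using p unfolding homog_def by blast
  qed
qed (simp add: homog_def)

lemma mdeg_add: "mdeg (\<alpha> + \<beta>) = mdeg \<alpha> + mdeg \<beta>"
proof -
  have *: "mdeg \<gamma> = (\<Sum>k\<in>A. Poly_Mapping.lookup \<gamma> k)" if "finite A" "Poly_Mapping.keys \<gamma> \<subseteq> A" for A \<gamma>
    unfolding mdeg_def by (rule sum.mono_neutral_left) (use that in \<open>auto simp: in_keys_iff\<close>)
  let ?A = "Poly_Mapping.keys \<alpha> \<union> Poly_Mapping.keys \<beta>"
  have "finite ?A" by simp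
  then show ?thesis
    using *[of ?A \<alpha>] *[of ?A \<beta>] *[of ?A "\<alpha> + \<beta>"] Poly_Mapping.keys_add[of \<alpha> \<beta>]
    by (simp add: lookup_add sum.distrib)
qed

lemma homog_mult: "homog d p \<Longrightarrow> homog e q \<Longrightarrow> homog (d + e) (p * q)"
  unfolding homog_def
proof
  fix \<alpha> assume p: "\<forall>\<alpha>\<in>Poly_Mapping.keys p. int (mdeg \<alpha>) = d"
    and q: "\<forall>\<alpha>\<in>Poly_Mapping.keys q. int (mdeg \<alpha>) = e"
    and "\<alpha> \<in> Poly_Mapping.keys (p * q)"
  then obtain \<beta> \<gamma> where "\<alpha> = \<beta> + \<gamma>" "\<beta> \<in> Poly_Mapping.keys p" "\<gamma> \<in> Poly_Mapping.keys q"
    using Poly_Mapping.keys_mult[of p q] by blast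
  then show "int (mdeg \<alpha>) = d + e" using p q by (simp add: mdeg_add)
qed

lemma homology_dim_nonzero_iff:
  fixes P :: "('b, 'k::field) free_complex"
  assumes P: "graded_free_resolution_of_field n P" and M: "ideal M (poly_ring n)"
  shows "homology_dim P M i j \<noteq> 0 \<longleftrightarrow> (\<exists>z\<in>cycles_deg P M i j. z \<notin> boundaries_deg P M i j)"
proof -
  interpret vs: vector_space "chain_scale :: 'k \<Rightarrow> ('b \<Rightarrow> 'k mpoly) \<Rightarrow> 'b \<Rightarrow> 'k mpoly"
    by (rule vector_space_chain_scale)
  interpret M: ideal M "poly_ring n" by (rule M)
  let ?S = "carrier (poly_ring n) :: 'k mpoly set"
  let ?Z = "cycles_deg P M i j" and ?B = "boundaries_deg P M i j"
  have MS: "M \<subseteq> ?S" using M.a_subset by simp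
  have M0: "0 \<in> M" using additive_subgroup.zero_closed[OF M.additive_subgroup_axioms] by simp
  have Madd: "p + q \<in> M" if "p \<in> M" "q \<in> M" for p q using additive_subgroup.a_closed[OF M.additive_subgroup_axioms that] by simp
  have Mmul: "p * q \<in> M" if "q \<in> M" "p \<in> ?S" for p q using M.I_l_closed[OF that] by simp
  have const: "Poly_Mapping.single 0 a \<in> ?S" for a by (auto simp: poly_ring_carrier_iff expos_def)
  have fin: "finite (fc_gens P i)" for i
    using P by (simp add: graded_free_resolution_of_field_def)
  have mat: "fc_mat P i b b' \<in> ?S" "homog (fc_deg P (Suc i) b - fc_deg P i b') (fc_mat P i b b')"
    if "b \<in> fc_gens P (Suc i)" "b' \<in> fc_gens P i" for i b b'
    using P that by (auto simp: graded_free_resolution_of_field_def)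
  have ex: "bd P i ` fc_chains P ?S (Suc i) \<subseteq> {c. case i of 0 \<Rightarrow> True | Suc m \<Rightarrow> bd P m c = 0}"
  proof (cases i)
    case (Suc m)
    have "{c\<in>fc_chains P ?S (Suc m). bd P m c = 0} = bd P (Suc m) ` fc_chains P ?S (Suc (Suc m))"
      using P by (simp add: graded_free_resolution_of_field_def)
    then show ?thesis using Suc by auto
  qed simp
  have sub: "vs.subspace (fc_chains_deg P M i j)" for i
    by (rule vs.subspaceI)
       (auto simp: fc_chains_deg_def fc_chains_def chain_scale_def M0 Madd Mmul const homog_closed)
  have bd_add: "bd P m (c + d) = bd P m c + bd P m d" for m c d
    by (auto simp: bd_def fun_eq_iff distrib_left sum.distrib)
  have bd_scale: "bd P m (chain_scale a c) = chain_scale a (bd P m c)" for m a c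
    by (auto simp: bd_def fun_eq_iff chain_scale_def sum_distrib_left mult.left_commute)
  have bd0: "bd P m 0 = 0" for m by (auto simp: bd_def fun_eq_iff)
  have Zsub: "vs.subspace ?Z"
    using sub[of i] by (cases i) (auto simp: vs.subspace_def cycles_deg_def bd_add bd_scale bd0 vs.scale_zero_right)
  have Bsub: "vs.subspace ?B"
    unfolding boundaries_deg_def
  proof (rule vs.subspaceI)
    show "0 \<in> bd P i ` fc_chains_deg P M (Suc i) j"
      using vs.subspace_0[OF sub] bd0 by (metis imageI)
    show "x + y \<in> bd P i ` fc_chains_deg P M (Suc i) j"
      if "x \<in> bd P i ` fc_chains_deg P M (Suc i) j" "y \<in> bd P i ` fc_chains_deg P M (Suc i) j" for x y
      using that vs.subspace_add[OF sub] by (auto simp flip: bd_add)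
    show "chain_scale a x \<in> bd P i ` fc_chains_deg P M (Suc i) j"
      if "x \<in> bd P i ` fc_chains_deg P M (Suc i) j" for a x
      using that vs.subspace_scale[OF sub] by (auto simp flip: bd_scale)
  qed
  have BZ: "?B \<subseteq> ?Z"
  proof
    fix x assume "x \<in> ?B"
    then obtain c where c: "c \<in> fc_chains_deg P M (Suc i) j" and x: "x = bd P i c"
      by (auto simp: boundaries_deg_def)
    have "c \<in> fc_chains P ?S (Suc i)" using c MS by (auto simp: fc_chains_deg_def fc_chains_def)
    then have 1: "case i of 0 \<Rightarrow> True | Suc m \<Rightarrow> bd P m x = 0" using ex x by blast
    have "x b' \<in> M \<and> homog (j - fc_deg P i b') (x b')" if b': "b' \<in> fc_gens P i" for b'
    proof -
      have t: "fc_mat P i b b' * c b \<in> M \<and> homog (j - fc_deg P i b') (fc_mat P i b b' * c b)"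
        if b: "b \<in> fc_gens P (Suc i)" for b
      proof -
        have "c b \<in> M" "homog (j - fc_deg P (Suc i) b) (c b)"
          using c b by (auto simp: fc_chains_deg_def fc_chains_def)
        then show ?thesis using mat[OF b b'] homog_mult[OF mat(2)[OF b b']] Mmul
          by (fastforce simp: algebra_simps)
      qed
      have "sum (\<lambda>b. fc_mat P i b b' * c b) A \<in> M \<and> homog (j - fc_deg P i b') (sum (\<lambda>b. fc_mat P i b b' * c b) A)"
        if "A \<subseteq> fc_gens P (Suc i)" for A
        using that t by (induction A rule: infinite_finite_induct) (auto simp: M0 Madd homog_closed)
      then show ?thesis using b' by (simp add: x bd_def)
    qed
    moreover have "x b' = 0" if "b' \<notin> fc_gens P i" for b' using that by (simp add: x bd_def)
    ultimately show "x \<in> ?Z" using 1 by (auto simp: cycles_deg_def fc_chains_deg_def fc_chains_def)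
  qed
  obtain W where W: "finite W" "fc_chains_deg P M i j \<subseteq> vs.span W"
    using chains_deg_finite_span[OF fin MS] by metis
  have ZW: "?Z \<subseteq> vs.span W" using W(2) by (auto simp: cycles_deg_def)
  obtain C where C: "C \<subseteq> ?B" "vs.independent C" "?B \<subseteq> vs.span C" "card C = vs.dim ?B"
    using vs.basis_exists by blast
  obtain D where D: "C \<subseteq> D" "D \<subseteq> ?Z" "vs.independent D" "?Z \<subseteq> vs.span D"
    using vs.maximal_independent_subset_extend[of C ?Z] C BZ by blast
  have finD: "finite D"
    using vs.independent_span_bound[OF W(1) D(3)] D(2) ZW by auto
  have dD: "card D = vs.dim ?Z" by (rule vs.basis_card_eq_dim) (use D in auto)
  have "homology_dim P M i j = card D - card C" by (simp add: homology_dim_def dD C)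
  moreover have "card D - card C = 0 \<longleftrightarrow> C = D"
    using card_seteq[OF finD D(1)] by auto
  moreover have "C = D \<longleftrightarrow> ?Z \<subseteq> ?B"
  proof
    assume "C = D"
    then show "?Z \<subseteq> ?B" using D(4) vs.span_minimal[OF C(1) Bsub] by auto
  next
    assume "?Z \<subseteq> ?B"
    then have "D \<subseteq> vs.span C" using D(2) C(3) by blast
    then have "card D \<le> card C"
      using vs.independent_span_bound[OF finite_subset[OF D(1) finD] D(3)] by auto
    then show "C = D" using card_seteq[OF finD D(1)] by auto
  qed
  ultimately show ?thesis by auto
qed

lemma tor_dim_nonzero_iff:
  assumes "ideal M (poly_ring n)"
  shows "tor_dim n M i j \<noteq> 0 \<longleftrightarrow>
    (\<exists>z\<in>cycles_deg (koszul n) M i j. z \<notin> boundaries_deg (koszul n) M i j)"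
  unfolding tor_dim_def by (rule homology_dim_nonzero_iff[OF koszul_resolution assms])

end

theory Submission
  imports Defs
begin

text \<open>
  All examples are squarefree monomial ideals generated in a single degree. Such an ideal is given
  by a finite family \<open>F\<close> of subsets of \<open>{1..n}\<close> of equal size, and its gradient ideal by the family
  of all \<open>w - {v}\<close> with \<open>v \<in> w \<in> F\<close> (\<open>gradient_sq_ideal\<close>). This holds in every characteristic,
  because the exponents in the monomial generators are \<open>1\<close>, and because in any homogeneous generating
  set the elements of lowest degree span the lowest degree component, so that the derivatives of the
  monomial generators are linear combinations of their derivatives. So the examples work over every field.

  Regularity is computed by adding one monomial at a time. If \<open>u\<close> is a monomial, the ideals \<open>I\<close> and
  \<open>(u)\<close> intersect in \<open>u \<cdot> (I : u)\<close>, and the Mayer-Vietoris sequence of \<open>Tor\<close> for \<open>I\<close> and \<open>(u)\<close> gives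
  \<open>reg (I + (u)) = deg u + s - 1\<close> with \<open>s = reg (I : u)\<close>, provided that \<open>s \<ge> 1\<close> and that \<open>reg I\<close> does not
  exceed this number (\<open>has_reg_insert\<close>). In a family of sets, \<open>I : u\<close> is obtained by replacing
  each \<open>w\<close> by \<open>w - u\<close>. Two standard computations follow: generators with disjoint supports have
  regularity \<open>1 + \<Sum> (deg u - 1)\<close> (\<open>has_reg_disjoint\<close>), and a squarefree strongly stable ideal
  generated in degree \<open>d\<close> has regularity \<open>d\<close> (\<open>has_reg_sq_stable\<close>).

  For \<open>a > 0\<close> take \<open>a\<close> disjoint edges: \<open>I = (x\<^sub>1 y\<^sub>1, \<dots>, x\<^sub>a y\<^sub>a)\<close> has regularity \<open>a + 1\<close>, whereas
  \<open>\<partial>(I)\<close> is generated by variables and has regularity \<open>1\<close>.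

  For \<open>a \<le> 0\<close> let \<open>m = 2 - a\<close> and take variables \<open>x\<^sub>k, y\<^sub>k, z\<^sub>k\<close> with \<open>1 \<le> k \<le> m\<close>. Let \<open>I\<close> be
  generated by the squarefree cubic monomials that contain at least two of the \<open>x\<^sub>k\<close>, and by
  \<open>x\<^sub>k y\<^sub>k z\<^sub>k\<close> for all \<open>k\<close>. The former generate a strongly stable ideal, and the colon ideal that
  arises when \<open>x\<^sub>k y\<^sub>k z\<^sub>k\<close> is added is generated by the other \<open>x\<^sub>j\<close>; so the regularity stays \<open>3\<close>.
  The ideal \<open>\<partial>(I)\<close> is the edge ideal of a graph in which every \<open>x\<^sub>j\<close> is joined to all other
  vertices and in which the remaining edges \<open>y\<^sub>k z\<^sub>k\<close> are disjoint. When the edge \<open>y\<^sub>k z\<^sub>k\<close> is added, the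
  colon ideal is generated by all \<open>x\<^sub>j\<close> and the previous \<open>k - 1\<close> edges, so its regularity is \<open>k\<close>. Hence
  \<open>\<partial>(I)\<close> has regularity \<open>m + 1\<close>, and the difference is \<open>3 - (m + 1) = a\<close>.
\<close>

section \<open>Spans of monomials\<close>

definition mspan :: "expo set \<Rightarrow> ('k::field) mpoly set" where
  "mspan U = {p. Poly_Mapping.keys p \<subseteq> U}"

definition up_closed :: "nat \<Rightarrow> expo set \<Rightarrow> bool" where
  "up_closed n U \<longleftrightarrow> U \<subseteq> expos n \<and> (\<forall>\<alpha>\<in>U. \<forall>\<beta>\<in>expos n. \<alpha> + \<beta> \<in> U)"

definition up_set :: "nat \<Rightarrow> expo set \<Rightarrow> expo set" where
  "up_set n A = {\<alpha> + \<beta> | \<alpha> \<beta>. \<alpha> \<in> A \<and> \<beta> \<in> expos n}"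

definition restrict_keys :: "expo set \<Rightarrow> ('k::field) mpoly \<Rightarrow> 'k mpoly" where
  "restrict_keys U p =
     (\<Sum>\<alpha>\<in>Poly_Mapping.keys p \<inter> U. Poly_Mapping.single \<alpha> (Poly_Mapping.lookup p \<alpha>))"

lemma lookup_restrict_keys:
  "Poly_Mapping.lookup (restrict_keys U p) \<alpha> = (if \<alpha> \<in> U then Poly_Mapping.lookup p \<alpha> else 0)"
  by (auto simp: restrict_keys_def lookup_sum lookup_single when_def in_keys_iff)

lemma poly_sum_singles:
  "(\<Sum>\<alpha>\<in>Poly_Mapping.keys p. Poly_Mapping.single \<alpha> (Poly_Mapping.lookup p \<alpha>)) = (p :: ('k::field) mpoly)"
  by (rule poly_mapping_eqI) (auto simp: lookup_sum lookup_single when_def in_keys_iff)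

lemma lookup_monomial_times:
  fixes p :: "('k::field) mpoly"
  shows "Poly_Mapping.lookup (Poly_Mapping.single \<mu> a * p) (\<mu> + \<gamma>) = a * Poly_Mapping.lookup p \<gamma>"
proof -
  have "Poly_Mapping.lookup (Poly_Mapping.single \<mu> a * p) (\<mu> + \<gamma>) =
      Poly_Mapping.lookup (Poly_Mapping.single \<mu> a *
        (\<Sum>\<alpha>\<in>Poly_Mapping.keys p. Poly_Mapping.single \<alpha> (Poly_Mapping.lookup p \<alpha>))) (\<mu> + \<gamma>)"
    by (simp only: poly_sum_singles)
  also have "\<dots> = a * Poly_Mapping.lookup p \<gamma>"
    by (auto simp: sum_distrib_left mult_single lookup_sum lookup_single when_def in_keys_iff)
  finally show ?thesis .
qed

lemma keys_monomial_times:
  fixes p :: "('k::field) mpoly"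
  shows "Poly_Mapping.keys (Poly_Mapping.single \<mu> a * p) \<subseteq> (+) \<mu> ` Poly_Mapping.keys p"
  using Poly_Mapping.keys_mult[of "Poly_Mapping.single \<mu> a" p] by (auto split: if_splits)

lemma monomial_times_eq_0: "Poly_Mapping.single \<mu> 1 * p = 0 \<Longrightarrow> p = (0 :: ('k::field) mpoly)"
  by auto (metis lookup_single_eq lookup_zero zero_neq_one)

lemma monomial_times_surj:
  assumes "q \<in> mspan ((+) \<mu> ` U)"
  shows "\<exists>p\<in>mspan U. q = Poly_Mapping.single \<mu> 1 * (p :: ('k::field) mpoly)"
proof
  let ?p = "\<Sum>\<gamma>\<in>Poly_Mapping.keys q. Poly_Mapping.single (\<gamma> - \<mu>) (Poly_Mapping.lookup q \<gamma>)"
  have k: "\<gamma> - \<mu> \<in> U" "\<mu> + (\<gamma> - \<mu>) = \<gamma>" if "\<gamma> \<in> Poly_Mapping.keys q" for \<gamma>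
    using assms that by (auto simp: mspan_def)
  show "?p \<in> mspan U"
    using k(1) Poly_Mapping.keys_sum[of "\<lambda>\<gamma>. Poly_Mapping.single (\<gamma> - \<mu>) (Poly_Mapping.lookup q \<gamma>)" "Poly_Mapping.keys q"]
    unfolding mspan_def by (auto split: if_splits)
  have "Poly_Mapping.single \<mu> 1 * ?p = (\<Sum>\<gamma>\<in>Poly_Mapping.keys q. Poly_Mapping.single \<gamma> (Poly_Mapping.lookup q \<gamma>))"
    by (simp add: sum_distrib_left mult_single k(2))
  then show "q = Poly_Mapping.single \<mu> 1 * ?p" by (simp add: poly_sum_singles)
qed

lemma mspan_closed:
  "0 \<in> mspan U" "p \<in> mspan U \<Longrightarrow> q \<in> mspan U \<Longrightarrow> p + q \<in> mspan U"
  by (simp_all add: mspan_def in_keys_iff subset_iff lookup_add) (metis add_0)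

lemma zero_in_expos [simp]: "0 \<in> expos n"
  by (simp add: expos_def)

lemma poly_ring_idealI:
  fixes J :: "('k::field) mpoly set"
  assumes sub: "J \<subseteq> carrier (poly_ring n)" and zero: "0 \<in> J"
    and add: "\<And>p q. p \<in> J \<Longrightarrow> q \<in> J \<Longrightarrow> p + q \<in> J"
    and mult: "\<And>p q. p \<in> J \<Longrightarrow> q \<in> carrier (poly_ring n) \<Longrightarrow> q * p \<in> J"
  shows "ideal J (poly_ring n)"
proof -
  interpret R: cring "poly_ring n :: 'k mpoly ring" by (rule poly_ring_cring)
  have inv: "\<ominus>\<^bsub>poly_ring n\<^esub> p = - p" if "p \<in> carrier (poly_ring n)" for p :: "'k mpoly"
    by (rule R.minus_equality) (use that in \<open>auto intro: poly_ring_closed\<close>)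
  have uminus: "- p \<in> J" if "p \<in> J" for p
    using mult[OF that, of "- 1"] by (simp add: poly_ring_closed)
  show ?thesis
  proof (rule idealI)
    show "ring (poly_ring n :: 'k mpoly ring)" by (rule R.ring_axioms)
    show "subgroup J (add_monoid (poly_ring n))"
    proof (rule R.add.subgroupI)
      show "J \<noteq> {}" using zero by blast
      show "\<ominus>\<^bsub>poly_ring n\<^esub> p \<in> J" if "p \<in> J" for p
        using uminus[OF that] inv sub that by auto
      show "p \<oplus>\<^bsub>poly_ring n\<^esub> q \<in> J" if "p \<in> J" "q \<in> J" for p q
        using add[OF that] by simp
    qed (use sub in simp)
    show "q \<otimes>\<^bsub>poly_ring n\<^esub> p \<in> J" "p \<otimes>\<^bsub>poly_ring n\<^esub> q \<in> J"
      if "p \<in> J" "q \<in> carrier (poly_ring n)" for p q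
      using mult[OF that] by (simp_all add: mult.commute)
  qed
qed

lemma mspan_ideal:
  assumes U: "up_closed n U"
  shows "ideal (mspan U) (poly_ring n :: ('k::field) mpoly ring)"
proof (rule poly_ring_idealI)
  show "mspan U \<subseteq> carrier (poly_ring n :: 'k mpoly ring)"
    using U by (auto simp: mspan_def up_closed_def poly_ring_carrier_iff)
  fix p q :: "'k mpoly" assume p: "p \<in> mspan U" and q: "q \<in> carrier (poly_ring n)"
  have "\<gamma> \<in> U" if "\<gamma> \<in> Poly_Mapping.keys (q * p)" for \<gamma>
  proof -
    obtain \<alpha> \<beta> where "\<gamma> = \<beta> + \<alpha>" "\<beta> \<in> Poly_Mapping.keys q" "\<alpha> \<in> Poly_Mapping.keys p"
      using Poly_Mapping.keys_mult[of q p] \<open>\<gamma> \<in> _\<close> by blast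
    moreover from this have "\<alpha> \<in> U" "\<beta> \<in> expos n"
      using p q unfolding mspan_def poly_ring_carrier_iff by blast+
    ultimately show ?thesis using U unfolding up_closed_def by (metis add.commute)
  qed
  then show "q * p \<in> mspan U" by (auto simp: mspan_def)
qed (simp_all add: mspan_closed)

lemma up_closed_up_set:
  assumes "A \<subseteq> expos n"
  shows "up_closed n (up_set n A)"
proof -
  have "\<gamma> + \<delta> \<in> up_set n A" if "\<gamma> \<in> up_set n A" "\<delta> \<in> expos n" for \<gamma> \<delta>
  proof -
    obtain \<alpha> \<beta> where g: "\<gamma> = \<alpha> + \<beta>" "\<alpha> \<in> A" "\<beta> \<in> expos n"
      using \<open>\<gamma> \<in> up_set n A\<close> unfolding up_set_def by blast
    have "\<gamma> + \<delta> = \<alpha> + (\<beta> + \<delta>)" by (simp add: g(1) add.assoc)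
    then show ?thesis using g(2) expos_add[OF g(3) \<open>\<delta> \<in> expos n\<close>] unfolding up_set_def by blast
  qed
  moreover have "up_set n A \<subseteq> expos n" using assms expos_add unfolding up_set_def by blast
  ultimately show ?thesis unfolding up_closed_def by blast
qed

lemma ideal_sum_closed:
  fixes f :: "'a \<Rightarrow> ('k::field) mpoly"
  assumes "ideal J (poly_ring n)" "\<And>x. x \<in> A \<Longrightarrow> f x \<in> J"
  shows "sum f A \<in> J"
proof -
  interpret J: ideal J "poly_ring n" by fact
  have z: "0 \<in> J" "\<And>x y. x \<in> J \<Longrightarrow> y \<in> J \<Longrightarrow> x + y \<in> J"
    using additive_subgroup.zero_closed[OF J.additive_subgroup_axioms]
      additive_subgroup.a_closed[OF J.additive_subgroup_axioms] by auto
  show ?thesis using assms(2) by (induction A rule: infinite_finite_induct) (auto simp: z)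
qed

lemma ideal_mult_closed:
  fixes p :: "('k::field) mpoly"
  assumes "ideal J (poly_ring n)" "p \<in> J" "q \<in> carrier (poly_ring n)"
  shows "q * p \<in> J"
  using ideal.I_l_closed[OF assms] by simp

lemma single_in_carrier: "\<alpha> \<in> expos n \<Longrightarrow> Poly_Mapping.single \<alpha> a \<in> carrier (poly_ring n)"
  by (auto simp: poly_ring_carrier_iff)

lemma Idl_monomials:
  assumes A: "A \<subseteq> expos n"
  shows "Idl\<^bsub>poly_ring n\<^esub> ((\<lambda>\<alpha>. Poly_Mapping.single \<alpha> (1::'k::field)) ` A) = mspan (up_set n A)"
    (is "Idl\<^bsub>?R\<^esub> ?G = _")
proof
  interpret R: cring "?R :: 'k mpoly ring" by (rule poly_ring_cring)
  have G: "?G \<subseteq> carrier ?R" using A by (auto intro: single_in_carrier)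
  have J: "ideal (Idl\<^bsub>?R\<^esub> ?G) ?R" by (rule R.genideal_ideal[OF G])
  have "?G \<subseteq> mspan (up_set n A)"
  proof (rule image_subsetI)
    fix \<alpha> assume "\<alpha> \<in> A"
    then have "\<alpha> + 0 \<in> up_set n A" unfolding up_set_def using zero_in_expos by blast
    then show "Poly_Mapping.single \<alpha> 1 \<in> mspan (up_set n A)" by (simp add: mspan_def)
  qed
  then show "Idl\<^bsub>?R\<^esub> ?G \<subseteq> mspan (up_set n A)"
    by (intro R.genideal_minimal mspan_ideal up_closed_up_set A)
  show "mspan (up_set n A) \<subseteq> Idl\<^bsub>?R\<^esub> ?G"
  proof
    fix p :: "'k mpoly" assume p: "p \<in> mspan (up_set n A)"
    have single: "Poly_Mapping.single \<gamma> a \<in> Idl\<^bsub>?R\<^esub> ?G" if "\<gamma> \<in> up_set n A" for \<gamma> a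
    proof -
      obtain \<alpha> \<beta> where g: "\<gamma> = \<alpha> + \<beta>" "\<alpha> \<in> A" "\<beta> \<in> expos n"
        using \<open>\<gamma> \<in> up_set n A\<close> unfolding up_set_def by blast
      have "Poly_Mapping.single \<alpha> 1 \<in> Idl\<^bsub>?R\<^esub> ?G" using R.genideal_self[OF G] g(2) by auto
      from ideal_mult_closed[OF J this single_in_carrier[OF g(3)], of a]
      show ?thesis by (simp add: mult_single g(1) add.commute)
    qed
    have "(\<Sum>\<alpha>\<in>Poly_Mapping.keys p. Poly_Mapping.single \<alpha> (Poly_Mapping.lookup p \<alpha>)) \<in> Idl\<^bsub>?R\<^esub> ?G"
      by (rule ideal_sum_closed[OF J], rule single) (use p in \<open>auto simp: mspan_def\<close>)
    then show "p \<in> Idl\<^bsub>?R\<^esub> ?G" by (simp add: poly_sum_singles)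
  qed
qed

section \<open>Koszul homology of monomial ideals\<close>

abbreviation kchains :: "nat \<Rightarrow> expo set \<Rightarrow> nat \<Rightarrow> int \<Rightarrow> (nat set \<Rightarrow> ('k::field) mpoly) set" where
  "kchains n U i j \<equiv> fc_chains_deg (koszul n) (mspan U) i j"

text \<open>
  Membership in the degree \<open>j\<close> part of the \<open>i\<close>-th Koszul module is a condition on single terms.
  This makes closure under sums and splitting along a union of exponent sets immediate.
\<close>

lemma kchains_iff:
  "c \<in> kchains n U i j \<longleftrightarrow>
    (\<forall>T \<gamma>. Poly_Mapping.lookup (c T) \<gamma> \<noteq> 0 \<longrightarrow> T \<in> ksets n i \<and> \<gamma> \<in> U \<and> int (mdeg \<gamma>) = j - int i)"
    (is "?L \<longleftrightarrow> ?R")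
proof
  have d: "fc_deg (koszul n) i T = int i" for T by (simp add: koszul_def)
  show ?R if ?L
  proof (intro allI impI)
    fix T \<gamma> assume nz: "Poly_Mapping.lookup (c T) \<gamma> \<noteq> 0"
    then have "c T \<noteq> 0" by auto
    then have "T \<in> ksets n i" using \<open>?L\<close> by (auto simp: fc_chains_deg_def fc_chains_def)
    then show "T \<in> ksets n i \<and> \<gamma> \<in> U \<and> int (mdeg \<gamma>) = j - int i"
      using \<open>?L\<close> nz by (auto simp: fc_chains_deg_def fc_chains_def mspan_def homog_def d in_keys_iff subset_iff)
  qed
  show ?L if ?R
  proof -
    have "c T = 0" if "T \<notin> ksets n i" for T
      by (rule poly_mapping_eqI) (use that \<open>?R\<close> in auto)
    then show ?thesis using \<open>?R\<close>
      by (simp add: fc_chains_deg_def fc_chains_def mspan_def homog_def d in_keys_iff subset_iff)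
  qed
qed

lemma kchains_mono: "c \<in> kchains n U i j \<Longrightarrow> U \<subseteq> V \<Longrightarrow> c \<in> kchains n V i j"
  unfolding kchains_iff by blast

lemma kchains_Int: "c \<in> kchains n U i j \<Longrightarrow> c \<in> kchains n V i j \<Longrightarrow> c \<in> kchains n (U \<inter> V) i j"
  unfolding kchains_iff by blast

lemma kchains_closed:
  "0 \<in> kchains n U i j"
  "c \<in> kchains n U i j \<Longrightarrow> d \<in> kchains n U i j \<Longrightarrow> c + d \<in> kchains n U i j"
  "c \<in> kchains n U i j \<Longrightarrow> d \<in> kchains n U i j \<Longrightarrow> c - d \<in> kchains n U i j"
proof -
  show "0 \<in> kchains n U i j" by (simp add: kchains_iff)
  assume cd: "c \<in> kchains n U i j" "d \<in> kchains n U i j"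
  have *: "Poly_Mapping.lookup (c T) \<gamma> \<noteq> 0 \<or> Poly_Mapping.lookup (d T) \<gamma> \<noteq> 0"
    if "Poly_Mapping.lookup ((c + d) T) \<gamma> \<noteq> 0 \<or> Poly_Mapping.lookup ((c - d) T) \<gamma> \<noteq> 0" for T \<gamma>
    using that by (auto simp: lookup_add lookup_minus)
  show "c + d \<in> kchains n U i j" "c - d \<in> kchains n U i j"
    using cd * unfolding kchains_iff by blast+
qed

lemma kchains_split:
  assumes "c \<in> kchains n (U \<union> V) i j"
  obtains a b where "a \<in> kchains n U i j" "b \<in> kchains n V i j" "c = a + b"
proof
  let ?a = "\<lambda>T. restrict_keys U (c T)"
  show "?a \<in> kchains n U i j" "c - ?a \<in> kchains n V i j"
    using assms by (auto simp: kchains_iff lookup_restrict_keys lookup_minus split: if_splits)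
qed simp

lemma bd_linear:
  "bd P m (c + d) = bd P m c + bd P m d"
  "bd P m (c - d) = bd P m c - bd P m d"
  "bd P m 0 = 0"
  by (auto simp: bd_def fun_eq_iff distrib_left right_diff_distrib sum.distrib sum_subtractf)

lemma mdeg_var_exp: "mdeg (var_exp k) = 1"
  by (simp add: mdeg_def var_exp_def)

lemma bd_kchains:
  assumes U: "up_closed n U" and c: "c \<in> kchains n U (Suc m) j"
  shows "bd (koszul n) m c \<in> kchains n U m j"
  unfolding kchains_iff
proof (intro allI impI)
  fix T \<gamma> assume nz: "Poly_Mapping.lookup (bd (koszul n) m c T) \<gamma> \<noteq> 0"
  then have T: "T \<in> ksets n m" by (intro ccontr[of "T \<in> ksets n m"]) (simp add: bd_def)
  obtain k where k: "k \<in> {1..n} - T" and g: "Poly_Mapping.lookup \<gamma> k \<noteq> 0"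
    and nz': "Poly_Mapping.lookup (c (insert k T)) (\<gamma> - var_exp k) \<noteq> 0"
  proof -
    have "(\<Sum>k\<in>{1..n} - T. if Poly_Mapping.lookup \<gamma> k = 0 then 0
        else (-1) ^ card {l\<in>T. l < k} * Poly_Mapping.lookup (c (insert k T)) (\<gamma> - var_exp k)) \<noteq> 0"
      using nz unfolding lookup_bd_koszul[OF T] .
    then obtain k where "k \<in> {1..n} - T" "(if Poly_Mapping.lookup \<gamma> k = 0 then 0
        else (-1) ^ card {l\<in>T. l < k} * Poly_Mapping.lookup (c (insert k T)) (\<gamma> - var_exp k)) \<noteq> 0"
      by (rule sum.not_neutral_contains_not_neutral)
    then show ?thesis using that[of k] by (cases "Poly_Mapping.lookup \<gamma> k = 0") simp_all
  qed
  have eq: "\<gamma> - var_exp k + var_exp k = \<gamma>" using exp_minus_var_eq[OF g] by metis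
  have "var_exp k \<in> expos n" using k by (auto simp: expos_def var_exp_def)
  moreover have 1: "\<gamma> - var_exp k \<in> U" "int (mdeg (\<gamma> - var_exp k)) = j - int (Suc m)"
    using c nz' unfolding kchains_iff by blast+
  ultimately have "\<gamma> \<in> U" using U eq unfolding up_closed_def by metis
  moreover have "mdeg \<gamma> = mdeg (\<gamma> - var_exp k) + 1"
    using mdeg_add[of "\<gamma> - var_exp k" "var_exp k"] by (simp add: eq mdeg_var_exp)
  ultimately show "T \<in> ksets n m \<and> \<gamma> \<in> U \<and> int (mdeg \<gamma>) = j - int m" using T 1 by simp
qed

text \<open>
  No condition is imposed for \<open>i = 0\<close>, where every chain is a cycle.
\<close>

definition kcycle :: "nat \<Rightarrow> nat \<Rightarrow> (nat set \<Rightarrow> ('k::field) mpoly) \<Rightarrow> bool" where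
  "kcycle n i z \<longleftrightarrow> (\<forall>m. i = Suc m \<longrightarrow> bd (koszul n) m z = 0)"

lemma kcycle_bd: "kcycle n i (bd (koszul n) i c)"
  by (auto simp: kcycle_def bd_koszul_bd)

lemma tor_dim_mspan_iff:
  assumes "up_closed n U"
  shows "tor_dim n (mspan U :: ('k::field) mpoly set) i j \<noteq> 0 \<longleftrightarrow>
    (\<exists>z\<in>kchains n U i j. kcycle n i (z :: nat set \<Rightarrow> 'k mpoly) \<and>
      (\<forall>c\<in>kchains n U (Suc i) j. z \<noteq> bd (koszul n) i c))"
proof -
  have "cycles_deg (koszul n) (mspan U) i j =
      {z \<in> kchains n U i j. kcycle n i (z :: nat set \<Rightarrow> 'k mpoly)}"
    by (cases i) (auto simp: cycles_deg_def kcycle_def)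
  then show ?thesis
    unfolding tor_dim_nonzero_iff[OF mspan_ideal[OF assms]] boundaries_deg_def by blast
qed

lemma up_closed_Un: "up_closed n U \<Longrightarrow> up_closed n V \<Longrightarrow> up_closed n (U \<union> V)"
  and up_closed_Int: "up_closed n U \<Longrightarrow> up_closed n V \<Longrightarrow> up_closed n (U \<inter> V)"
  unfolding up_closed_def by blast+

text \<open>
  This and the next lemma are two parts of the exactness of the Mayer-Vietoris sequence
  \<open>Tor\<^sub>i(I) \<oplus> Tor\<^sub>i(J) \<rightarrow> Tor\<^sub>i(I + J) \<rightarrow> Tor\<^bsub>i-1\<^esub>(I \<inter> J) \<rightarrow> Tor\<^bsub>i-1\<^esub>(I) \<oplus> Tor\<^bsub>i-1\<^esub>(J)\<close>
  for monomial ideals, where a chain with coefficients in \<open>I + J\<close> splits monomial by monomial.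
  If \<open>z = a + b\<close> is a cycle, the boundary of \<open>a\<close> is a cycle over \<open>I \<inter> J\<close>; once it is bounded by a
  chain \<open>c\<close> there, \<open>a - c\<close> and \<open>b + c\<close> are cycles over \<open>I\<close> and \<open>J\<close>.
\<close>

lemma tor_Un_eq_0:
  assumes U: "up_closed n U" and V: "up_closed n V"
    and U0: "tor_dim n (mspan U :: ('k::field) mpoly set) i j = 0"
    and V0: "tor_dim n (mspan V :: 'k mpoly set) i j = 0"
    and UV0: "\<And>m. i = Suc m \<Longrightarrow> tor_dim n (mspan (U \<inter> V) :: 'k mpoly set) m j = 0"
  shows "tor_dim n (mspan (U \<union> V) :: 'k mpoly set) i j = 0"
proof -
  have UV: "up_closed n (U \<union> V)" "up_closed n (U \<inter> V)"
    using U V by (simp_all add: up_closed_Un up_closed_Int)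
  have "\<exists>e\<in>kchains n (U \<union> V) (Suc i) j. z = bd (koszul n) i e"
    if z: "z \<in> kchains n (U \<union> V) i j" and cyc: "kcycle n i z" for z :: "nat set \<Rightarrow> 'k mpoly"
  proof -
    obtain a b where ab: "a \<in> kchains n U i j" "b \<in> kchains n V i j" and zab: "z = a + b"
      using kchains_split[OF z] .
    have "\<exists>c\<in>kchains n (U \<inter> V) i j. kcycle n i (a - c) \<and> kcycle n i (b + c)"
    proof (cases i)
      case 0
      then show ?thesis by (intro bexI[of _ 0] kchains_closed(1)) (simp add: kcycle_def)
    next
      case (Suc m)
      let ?w = "bd (koszul n) m a"
      have eq: "?w = - bd (koszul n) m b"
        using cyc Suc by (simp add: kcycle_def zab bd_linear eq_neg_iff_add_eq_0)
      have "?w \<in> kchains n U m j" using bd_kchains[OF U] ab(1) Suc by blast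
      moreover have "bd (koszul n) m b \<in> kchains n V m j" using bd_kchains[OF V] ab(2) Suc by blast
      then have "0 - bd (koszul n) m b \<in> kchains n V m j" by (intro kchains_closed)
      ultimately have "?w \<in> kchains n (U \<inter> V) m j" by (intro kchains_Int) (simp_all add: eq)
      then obtain c where c: "c \<in> kchains n (U \<inter> V) (Suc m) j" "?w = bd (koszul n) m c"
        using UV0[OF Suc] tor_dim_mspan_iff[OF UV(2), of m j, where ?'k = 'k] kcycle_bd by blast
      have "kcycle n i (a - c)" "kcycle n i (b + c)"
        using eq c(2) by (auto simp: kcycle_def Suc bd_linear)
      then show ?thesis using c(1) Suc by auto
    qed
    then obtain c where c: "c \<in> kchains n (U \<inter> V) i j" "kcycle n i (a - c)" "kcycle n i (b + c)"
      by blast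
    have "a - c \<in> kchains n U i j" "b + c \<in> kchains n V i j"
      using ab kchains_mono[OF c(1)] by (auto intro!: kchains_closed)
    then obtain a' b' where "a' \<in> kchains n U (Suc i) j" "a - c = bd (koszul n) i a'"
      "b' \<in> kchains n V (Suc i) j" "b + c = bd (koszul n) i b'"
      using U0 V0 c tor_dim_mspan_iff[OF U, of i j, where ?'k = 'k]
        tor_dim_mspan_iff[OF V, of i j, where ?'k = 'k] by blast
    moreover have "z = (a - c) + (b + c)" by (simp add: zab)
    ultimately have "z = bd (koszul n) i (a' + b')" "a' + b' \<in> kchains n (U \<union> V) (Suc i) j"
      by (auto simp: bd_linear intro!: kchains_closed elim: kchains_mono)
    then show ?thesis by blast
  qed
  then show ?thesis using tor_dim_mspan_iff[OF UV(1), of i j, where ?'k = 'k] by blast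
qed

text \<open>
  A class in the kernel of \<open>Tor\<^sub>i(I \<inter> J) \<rightarrow> Tor\<^sub>i(I) \<oplus> Tor\<^sub>i(J)\<close> is bounded by some \<open>a\<close> over \<open>I\<close> and by
  some \<open>b\<close> over \<open>J\<close>, and it is the image of the class of \<open>a - b\<close> under the connecting map.
\<close>

lemma tor_Un_neq_0:
  assumes U: "up_closed n U" and V: "up_closed n V"
    and U0: "tor_dim n (mspan U :: ('k::field) mpoly set) i j = 0"
    and V0: "tor_dim n (mspan V :: 'k mpoly set) i j = 0"
    and UV0: "tor_dim n (mspan (U \<inter> V) :: 'k mpoly set) i j \<noteq> 0"
  shows "tor_dim n (mspan (U \<union> V) :: 'k mpoly set) (Suc i) j \<noteq> 0"
proof -
  have UV: "up_closed n (U \<union> V)" "up_closed n (U \<inter> V)"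
    using U V by (simp_all add: up_closed_Un up_closed_Int)
  \<comment> \<open>a class of the intersection, which becomes a boundary over either ideal\<close>
  obtain w :: "nat set \<Rightarrow> 'k mpoly" where w: "w \<in> kchains n (U \<inter> V) i j" "kcycle n i w"
    and nb: "\<And>c. c \<in> kchains n (U \<inter> V) (Suc i) j \<Longrightarrow> w \<noteq> bd (koszul n) i c"
    using UV0 tor_dim_mspan_iff[OF UV(2)] by blast
  have "w \<in> kchains n U i j" "w \<in> kchains n V i j" using kchains_mono[OF w(1)] by auto
  then obtain a b where a: "a \<in> kchains n U (Suc i) j" "w = bd (koszul n) i a"
    and b: "b \<in> kchains n V (Suc i) j" "w = bd (koszul n) i b"
    using w(2) U0 V0 tor_dim_mspan_iff[OF U, of i j, where ?'k = 'k]
      tor_dim_mspan_iff[OF V, of i j, where ?'k = 'k] by metis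
  have "a - b \<in> kchains n (U \<union> V) (Suc i) j"
    using kchains_mono[OF a(1)] kchains_mono[OF b(1)] by (auto intro!: kchains_closed)
  moreover have "kcycle n (Suc i) (a - b)" by (simp add: kcycle_def bd_linear flip: a(2) b(2))
  moreover have "a - b \<noteq> bd (koszul n) (Suc i) e" if e: "e \<in> kchains n (U \<union> V) (Suc (Suc i)) j" for e
  proof
    assume eq: "a - b = bd (koszul n) (Suc i) e"
    obtain e1 e2 where e12: "e1 \<in> kchains n U (Suc (Suc i)) j" "e2 \<in> kchains n V (Suc (Suc i)) j"
      and ee: "e = e1 + e2" using kchains_split[OF e] .
    let ?c = "a - bd (koszul n) (Suc i) e1"
    have c: "?c = b + bd (koszul n) (Suc i) e2"
      using eq unfolding ee bd_linear by (simp add: algebra_simps)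
    have "?c \<in> kchains n U (Suc i) j" by (intro kchains_closed a(1) bd_kchains U e12)
    moreover have "?c \<in> kchains n V (Suc i) j"
      unfolding c by (intro kchains_closed b(1) bd_kchains V e12)
    ultimately have "?c \<in> kchains n (U \<inter> V) (Suc i) j" by (rule kchains_Int)
    moreover have "w = bd (koszul n) i ?c" by (simp add: bd_linear bd_koszul_bd a(2))
    ultimately show False using nb by blast
  qed
  ultimately show ?thesis using tor_dim_mspan_iff[OF UV(1)] by blast
qed

text \<open>
  Multiplication by \<open>x\<^sup>\<mu>\<close> is an isomorphism of \<open>I\<close> onto \<open>x\<^sup>\<mu> I\<close> that raises degrees by the degree of
  \<open>\<mu>\<close>, and it commutes with the Koszul differential.
\<close>

lemma tor_monomial_times:
  assumes U: "up_closed n U" and \<mu>: "\<mu> \<in> expos n"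
  shows "up_closed n ((+) \<mu> ` U)"
    and "tor_dim n (mspan ((+) \<mu> ` U) :: ('k::field) mpoly set) i (j + int (mdeg \<mu>)) \<noteq> 0 \<longleftrightarrow>
      tor_dim n (mspan U :: 'k mpoly set) i j \<noteq> 0"
proof -
  define f where "f = (\<lambda>(c :: nat set \<Rightarrow> 'k mpoly) T. Poly_Mapping.single \<mu> 1 * c T)"
  show V: "up_closed n ((+) \<mu> ` U)"
    unfolding up_closed_def
  proof (intro conjI ballI)
    show "(+) \<mu> ` U \<subseteq> expos n" using U expos_add[OF \<mu>] unfolding up_closed_def by blast
    fix \<gamma> \<delta> assume "\<gamma> \<in> (+) \<mu> ` U" and d: "\<delta> \<in> expos n"
    then obtain \<alpha> where a: "\<gamma> = \<mu> + \<alpha>" "\<alpha> \<in> U" by blast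
    have "\<alpha> + \<delta> \<in> U" using U a(2) d unfolding up_closed_def by blast
    then show "\<gamma> + \<delta> \<in> (+) \<mu> ` U" by (simp add: a(1) add.assoc)
  qed
  have f_chain: "f c \<in> kchains n ((+) \<mu> ` U) i (j + int (mdeg \<mu>))" if c: "c \<in> kchains n U i j" for c i
    unfolding kchains_iff
  proof (intro allI impI)
    fix T \<gamma> assume "Poly_Mapping.lookup (f c T) \<gamma> \<noteq> 0"
    then obtain \<alpha> where a: "\<gamma> = \<mu> + \<alpha>" "Poly_Mapping.lookup (c T) \<alpha> \<noteq> 0"
      using keys_monomial_times[of \<mu> 1 "c T"] by (auto simp: f_def in_keys_iff subset_iff)
    have "T \<in> ksets n i \<and> \<alpha> \<in> U \<and> int (mdeg \<alpha>) = j - int i"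
      using c a(2) unfolding kchains_iff by blast
    then show "T \<in> ksets n i \<and> \<gamma> \<in> (+) \<mu> ` U \<and> int (mdeg \<gamma>) = j + int (mdeg \<mu>) - int i"
      by (simp add: a(1) mdeg_add)
  qed
  have f_surj: "\<exists>c\<in>kchains n U i j. d = f c" if d: "d \<in> kchains n ((+) \<mu> ` U) i (j + int (mdeg \<mu>))" for d i
  proof -
    define E where "E T = {\<alpha> \<in> U. T \<in> ksets n i \<and> int (mdeg \<alpha>) = j - int i}" for T
    have "\<exists>p\<in>mspan (E T). d T = Poly_Mapping.single \<mu> 1 * p" for T
    proof (rule monomial_times_surj)
      have "\<gamma> \<in> (+) \<mu> ` E T" if nz: "Poly_Mapping.lookup (d T) \<gamma> \<noteq> 0" for \<gamma>
      proof -
        have *: "T \<in> ksets n i" "\<gamma> \<in> (+) \<mu> ` U" "int (mdeg \<gamma>) = j + int (mdeg \<mu>) - int i"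
          using d nz unfolding kchains_iff by blast+
        then obtain \<alpha> where "\<gamma> = \<mu> + \<alpha>" "\<alpha> \<in> U" by blast
        then show ?thesis using * by (auto simp: E_def mdeg_add)
      qed
      then show "d T \<in> mspan ((+) \<mu> ` E T)" by (auto simp: mspan_def in_keys_iff)
    qed
    then obtain c where c: "\<And>T. c T \<in> mspan (E T)" "\<And>T. d T = Poly_Mapping.single \<mu> 1 * c T"
      by metis
    have "c \<in> kchains n U i j"
      unfolding kchains_iff
    proof (intro allI impI)
      fix T \<gamma> assume "Poly_Mapping.lookup (c T) \<gamma> \<noteq> 0"
      then have "\<gamma> \<in> E T" using c(1)[of T] unfolding mspan_def in_keys_iff[symmetric] by blast
      then show "T \<in> ksets n i \<and> \<gamma> \<in> U \<and> int (mdeg \<gamma>) = j - int i" by (simp add: E_def)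
    qed
    moreover have "d = f c" using c(2) by (simp add: f_def fun_eq_iff)
    ultimately show ?thesis by blast
  qed
  have f_bd: "bd (koszul n) m (f c) = f (bd (koszul n) m c)" for m c
    by (auto simp: f_def bd_def fun_eq_iff sum_distrib_left mult.left_commute)
  have f_diff: "f c - f d = f (c - d)" for c d by (simp add: f_def fun_eq_iff right_diff_distrib)
  have f_0: "f c = 0 \<longleftrightarrow> c = 0" for c
  proof
    show "c = 0" if "f c = 0"
      using that monomial_times_eq_0[of \<mu>] unfolding f_def fun_eq_iff zero_fun_def by blast
  qed (simp add: f_def fun_eq_iff)
  have f_inj: "f c = f d \<longleftrightarrow> c = d" for c d
    using f_diff[of c d] f_0[of "c - d"] by (metis right_minus_eq)
  have f_cyc: "kcycle n i (f c) \<longleftrightarrow> kcycle n i c" for c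
    by (simp add: kcycle_def f_bd f_0)
  show "tor_dim n (mspan ((+) \<mu> ` U) :: 'k mpoly set) i (j + int (mdeg \<mu>)) \<noteq> 0 \<longleftrightarrow>
      tor_dim n (mspan U :: 'k mpoly set) i j \<noteq> 0"
  proof
    assume "tor_dim n (mspan ((+) \<mu> ` U) :: 'k mpoly set) i (j + int (mdeg \<mu>)) \<noteq> 0"
    then obtain z :: "nat set \<Rightarrow> 'k mpoly" where z: "z \<in> kchains n ((+) \<mu> ` U) i (j + int (mdeg \<mu>))" "kcycle n i z"
      "\<And>c. c \<in> kchains n ((+) \<mu> ` U) (Suc i) (j + int (mdeg \<mu>)) \<Longrightarrow> z \<noteq> bd (koszul n) i c"
      unfolding tor_dim_mspan_iff[OF V] by blast
    obtain y where y: "y \<in> kchains n U i j" "z = f y" using f_surj[OF z(1)] by blast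
    have "kcycle n i y" using z(2) by (simp add: y(2) f_cyc)
    moreover have "y \<noteq> bd (koszul n) i c" if "c \<in> kchains n U (Suc i) j" for c
      using z(3)[OF f_chain[OF that]] by (auto simp: y(2) f_bd)
    ultimately show "tor_dim n (mspan U :: 'k mpoly set) i j \<noteq> 0"
      unfolding tor_dim_mspan_iff[OF U] using y(1) by blast
  next
    assume "tor_dim n (mspan U :: 'k mpoly set) i j \<noteq> 0"
    then obtain y :: "nat set \<Rightarrow> 'k mpoly" where y: "y \<in> kchains n U i j" "kcycle n i y"
      "\<And>c. c \<in> kchains n U (Suc i) j \<Longrightarrow> y \<noteq> bd (koszul n) i c"
      unfolding tor_dim_mspan_iff[OF U] by blast
    have "kcycle n i (f y)" using y(2) by (simp add: f_cyc)
    moreover have "f y \<noteq> bd (koszul n) i d" if d: "d \<in> kchains n ((+) \<mu> ` U) (Suc i) (j + int (mdeg \<mu>))" for d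
    proof -
      obtain c where c: "c \<in> kchains n U (Suc i) j" "d = f c" using f_surj[OF d] by blast
      then show ?thesis using y(3)[OF c(1)] by (simp add: f_bd f_inj)
    qed
    ultimately show "tor_dim n (mspan ((+) \<mu> ` U) :: 'k mpoly set) i (j + int (mdeg \<mu>)) \<noteq> 0"
      unfolding tor_dim_mspan_iff[OF V] using f_chain[OF y(1)] by blast
  qed
qed

section \<open>Regularity\<close>

text \<open>
  The regularity as an attained upper bound; unlike the maximum of a set of integers, this is
  meaningful without knowing that the set is finite and nonempty.
\<close>

definition has_reg :: "nat \<Rightarrow> ('k::field) mpoly set \<Rightarrow> int \<Rightarrow> bool" where
  "has_reg n M r \<longleftrightarrow> (\<exists>i. tor_dim n M i (r + int i) \<noteq> 0) \<and> (\<forall>i j. tor_dim n M i j \<noteq> 0 \<longrightarrow> j - int i \<le> r)"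

text \<open>
  A nonzero class in \<open>Tor\<^sub>i\<close> of degree \<open>j\<close> is represented by a nonzero chain whose coefficients have
  degree \<open>j - i\<close>, so the values \<open>j - i\<close> are also bounded below and form a finite set.
\<close>

lemma regularity_eqI:
  assumes U: "up_closed n U" and r: "has_reg n (mspan U :: ('k::field) mpoly set) r"
  shows "regularity n (mspan U :: 'k mpoly set) = r"
proof -
  let ?D = "{j - int i | i j. tor_dim n (mspan U :: 'k mpoly set) i j \<noteq> 0}"
  have nonneg: "0 \<le> j - int i" if "tor_dim n (mspan U :: 'k mpoly set) i j \<noteq> 0" for i j
  proof -
    obtain z :: "nat set \<Rightarrow> 'k mpoly" where z: "z \<in> kchains n U i j" "z \<noteq> bd (koszul n) i 0"
      using \<open>tor_dim _ _ _ _ \<noteq> 0\<close> kchains_closed(1) unfolding tor_dim_mspan_iff[OF U] by blast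
    then have "z \<noteq> 0" by (simp add: bd_linear)
    then obtain T where "z T \<noteq> 0" by (auto simp: fun_eq_iff)
    then obtain \<gamma> where "Poly_Mapping.lookup (z T) \<gamma> \<noteq> 0" by (auto simp: poly_mapping_eq_iff fun_eq_iff)
    then have "int (mdeg \<gamma>) = j - int i" using z(1) unfolding kchains_iff by blast
    then show ?thesis by linarith
  qed
  have "?D \<subseteq> {0..r}" using r nonneg unfolding has_reg_def by auto
  then have "finite ?D" by (rule finite_subset) simp
  moreover have "r \<in> ?D" using r unfolding has_reg_def by force
  moreover have "x \<le> r" if "x \<in> ?D" for x using that r unfolding has_reg_def by blast
  ultimately show ?thesis unfolding regularity_def by (intro Max_eqI)
qed

lemma up_closed_expos: "up_closed n (expos n)"
  by (simp add: up_closed_def expos_add)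

text \<open>
  The Koszul complex resolves the field, so \<open>Tor(K, S) = K\<close> sits in homological and internal degree
  \<open>0\<close>. The contracting homotopy of the complex preserves the grading.
\<close>

lemma has_reg_poly_ring: "has_reg n (mspan (expos n) :: ('k::field) mpoly set) 0"
  unfolding has_reg_def
proof
  let ?z = "\<lambda>T. if T = {} then 1 else 0 :: 'k mpoly"
  have e: "{} \<in> ksets n 0" by (simp add: ksets_def)
  have "?z \<in> kchains n (expos n) 0 0"
    by (simp add: kchains_iff koszul_gens_0 lookup_one when_def mdeg_def)
  moreover have "kcycle n 0 ?z" by (simp add: kcycle_def)
  moreover have "?z \<noteq> bd (koszul n) 0 c" for c
  proof
    assume "?z = bd (koszul n) 0 c"
    from fun_cong[OF this, of "{}"] have "bd (koszul n) 0 c {} = 1" by (simp only: if_True refl)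
    then have "Poly_Mapping.lookup (bd (koszul n) 0 c {}) 0 = (1::'k)" by (simp only: lookup_one_zero)
    then show False by (simp add: lookup_bd_koszul[OF e])
  qed
  ultimately have "tor_dim n (mspan (expos n) :: 'k mpoly set) 0 0 \<noteq> 0"
    unfolding tor_dim_mspan_iff[OF up_closed_expos] by blast
  then show "\<exists>i. tor_dim n (mspan (expos n) :: 'k mpoly set) i (0 + int i) \<noteq> 0"
    by (intro exI[of _ 0]) simp
  show "\<forall>i j. tor_dim n (mspan (expos n) :: 'k mpoly set) i j \<noteq> 0 \<longrightarrow> j - int i \<le> 0"
  proof (intro allI impI, rule ccontr)
    fix i j assume t: "tor_dim n (mspan (expos n) :: 'k mpoly set) i j \<noteq> 0" and j: "\<not> j - int i \<le> 0"
    then obtain z :: "nat set \<Rightarrow> 'k mpoly" where z: "z \<in> kchains n (expos n) i j" "kcycle n i z"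
      and nb: "\<And>c. c \<in> kchains n (expos n) (Suc i) j \<Longrightarrow> z \<noteq> bd (koszul n) i c"
      unfolding tor_dim_mspan_iff[OF up_closed_expos] by blast
    have zc: "z \<in> fc_chains (koszul n) (carrier (poly_ring n)) i"
      using z(1) by (auto simp: fc_chains_deg_def fc_chains_def mspan_def poly_ring_carrier_iff)
    let ?h = "koszul_homotopy n i z"
    have "?h \<in> kchains n (expos n) (Suc i) j"
      unfolding kchains_iff
    proof (intro allI impI)
      fix T \<gamma> assume nz: "Poly_Mapping.lookup (?h T) \<gamma> \<noteq> 0"
      then have T: "T \<in> ksets n (Suc i)" by (intro ccontr[of "T \<in> _"]) (simp add: koszul_homotopy_def)
      then have "Poly_Mapping.lookup (z (T - {Min T})) (\<gamma> + var_exp (Min T)) \<noteq> 0"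
        using nz by (simp add: lookup_koszul_homotopy split: if_splits)
      then have "\<gamma> + var_exp (Min T) \<in> expos n" "int (mdeg (\<gamma> + var_exp (Min T))) = j - int i"
        using z(1) unfolding kchains_iff by blast+
      then show "T \<in> ksets n (Suc i) \<and> \<gamma> \<in> expos n \<and> int (mdeg \<gamma>) = j - int (Suc i)"
        using T by (simp add: expos_def keys_add_var mdeg_add mdeg_var_exp)
    qed
    moreover have "bd (koszul n) i ?h = z"
    proof (rule bd_koszul_homotopy[OF zc])
      show "Poly_Mapping.lookup (z {}) 0 = 0" if "i = 0"
      proof (rule ccontr)
        assume "Poly_Mapping.lookup (z {}) 0 \<noteq> 0"
        then have "int (mdeg 0) = j - int i" using z(1) unfolding kchains_iff by blast
        then show False using j by (simp add: mdeg_def)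
      qed
    qed (use z(2) in \<open>simp add: kcycle_def\<close>)
    ultimately show False using nb by metis
  qed
qed

lemma has_reg_monomial_times:
  assumes U: "up_closed n U" and \<mu>: "\<mu> \<in> expos n" and r: "has_reg n (mspan U :: ('k::field) mpoly set) r"
  shows "has_reg n (mspan ((+) \<mu> ` U) :: 'k mpoly set) (r + int (mdeg \<mu>))"
  unfolding has_reg_def
proof
  obtain i where "tor_dim n (mspan U :: 'k mpoly set) i (r + int i) \<noteq> 0"
    using r unfolding has_reg_def by blast
  then have "tor_dim n (mspan ((+) \<mu> ` U) :: 'k mpoly set) i (r + int i + int (mdeg \<mu>)) \<noteq> 0"
    using tor_monomial_times(2)[OF U \<mu>] by blast
  then show "\<exists>i. tor_dim n (mspan ((+) \<mu> ` U) :: 'k mpoly set) i (r + int (mdeg \<mu>) + int i) \<noteq> 0"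
    by (intro exI[of _ i]) (simp add: add_ac)
  show "\<forall>i j. tor_dim n (mspan ((+) \<mu> ` U) :: 'k mpoly set) i j \<noteq> 0 \<longrightarrow> j - int i \<le> r + int (mdeg \<mu>)"
  proof (intro allI impI)
    fix i j assume "tor_dim n (mspan ((+) \<mu> ` U) :: 'k mpoly set) i j \<noteq> 0"
    then have "tor_dim n (mspan ((+) \<mu> ` U) :: 'k mpoly set) i (j - int (mdeg \<mu>) + int (mdeg \<mu>)) \<noteq> 0"
      by simp
    then have "tor_dim n (mspan U :: 'k mpoly set) i (j - int (mdeg \<mu>)) \<noteq> 0"
      using tor_monomial_times(2)[OF U \<mu>] by blast
    then have "j - int (mdeg \<mu>) - int i \<le> r" using r unfolding has_reg_def by blast
    then show "j - int i \<le> r + int (mdeg \<mu>)" by linarith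
  qed
qed

text \<open>
  Write \<open>J = (x\<^sup>\<mu>)\<close>, so that \<open>I \<inter> J\<close> is \<open>x\<^sup>\<mu>\<close> times the colon ideal, of regularity \<open>deg \<mu> + s\<close>. This
  exceeds both \<open>reg I\<close> and \<open>reg J = deg \<mu>\<close>, so the extremal class of \<open>I \<inter> J\<close> maps to zero in both
  and lifts to \<open>I + J\<close> with homological degree raised by one. The same sequence bounds
  \<open>reg (I + J)\<close> from above.
\<close>

lemma has_reg_add_monomial:
  assumes U: "up_closed n U" and \<mu>: "\<mu> \<in> expos n"
    and r: "has_reg n (mspan U :: ('k::field) mpoly set) r"
    and s: "has_reg n (mspan {\<alpha> \<in> expos n. \<mu> + \<alpha> \<in> U} :: 'k mpoly set) s"
    and rs: "1 \<le> s" "r \<le> int (mdeg \<mu>) + s - 1"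
  shows "has_reg n (mspan (U \<union> (+) \<mu> ` expos n) :: 'k mpoly set) (int (mdeg \<mu>) + s - 1)"
proof -
  let ?V = "(+) \<mu> ` expos n" and ?W = "{\<alpha> \<in> expos n. \<mu> + \<alpha> \<in> U}" and ?d = "int (mdeg \<mu>)"
  have V: "up_closed n ?V" by (rule tor_monomial_times(1)[OF up_closed_expos \<mu>])
  have W: "up_closed n ?W"
    using U expos_add unfolding up_closed_def by (simp flip: add.assoc)
  have UV: "U \<inter> ?V = (+) \<mu> ` ?W" by blast
  have regV: "has_reg n (mspan ?V :: 'k mpoly set) ?d"
    using has_reg_monomial_times[OF up_closed_expos \<mu> has_reg_poly_ring] by simp
  have regUV: "has_reg n (mspan (U \<inter> ?V) :: 'k mpoly set) (s + ?d)"
    unfolding UV by (rule has_reg_monomial_times[OF W \<mu> s])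
  have U0: "tor_dim n (mspan U :: 'k mpoly set) i j = 0" if "?d + s - 1 < j - int i" for i j
    using r rs that unfolding has_reg_def by force
  have V0: "tor_dim n (mspan ?V :: 'k mpoly set) i j = 0" if "?d + s - 1 < j - int i" for i j
    using regV rs that unfolding has_reg_def by force
  show ?thesis
    unfolding has_reg_def
  proof
    obtain i where i: "tor_dim n (mspan (U \<inter> ?V) :: 'k mpoly set) i (s + ?d + int i) \<noteq> 0"
      using regUV unfolding has_reg_def by blast
    have "tor_dim n (mspan (U \<union> ?V) :: 'k mpoly set) (Suc i) (s + ?d + int i) \<noteq> 0"
      by (rule tor_Un_neq_0[OF U V U0 V0 i]) simp_all
    moreover have "s + ?d + int i = ?d + s - 1 + int (Suc i)" by simp
    ultimately show "\<exists>i. tor_dim n (mspan (U \<union> ?V) :: 'k mpoly set) i (?d + s - 1 + int i) \<noteq> 0"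
      by metis
    show "\<forall>i j. tor_dim n (mspan (U \<union> ?V) :: 'k mpoly set) i j \<noteq> 0 \<longrightarrow> j - int i \<le> ?d + s - 1"
    proof (intro allI impI, rule ccontr)
      fix i j assume t: "tor_dim n (mspan (U \<union> ?V) :: 'k mpoly set) i j \<noteq> 0" and gt: "\<not> j - int i \<le> ?d + s - 1"
      have "tor_dim n (mspan (U \<inter> ?V) :: 'k mpoly set) m j = 0" if "i = Suc m" for m
      proof (rule ccontr)
        assume "tor_dim n (mspan (U \<inter> ?V) :: 'k mpoly set) m j \<noteq> 0"
        then have "j - int m \<le> s + ?d" using regUV unfolding has_reg_def by blast
        then show False using gt that by simp
      qed
      then have "tor_dim n (mspan (U \<union> ?V) :: 'k mpoly set) i j = 0"
        using gt by (intro tor_Un_eq_0[OF U V U0 V0]) simp_all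
      then show False using t by simp
    qed
  qed
qed

section \<open>Squarefree monomial ideals\<close>

text \<open>
  The exponent vector of the squarefree monomial with support \<open>w\<close>.
\<close>

definition sq_exp :: "nat set \<Rightarrow> expo" where
  "sq_exp w = (\<Sum>k\<in>w. var_exp k)"

definition sq_set :: "nat \<Rightarrow> nat set set \<Rightarrow> expo set" where
  "sq_set n F = {\<alpha> \<in> expos n. \<exists>w\<in>F. w \<subseteq> Poly_Mapping.keys \<alpha>}"

abbreviation sq_ideal :: "nat \<Rightarrow> nat set set \<Rightarrow> ('k::field) mpoly set" where
  "sq_ideal n F \<equiv> mspan (sq_set n F)"

lemma lookup_sq_exp: "finite w \<Longrightarrow> Poly_Mapping.lookup (sq_exp w) k = (if k \<in> w then 1 else 0)"
  by (simp add: sq_exp_def lookup_sum lookup_var_exp)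

lemma keys_sq_exp: "finite w \<Longrightarrow> Poly_Mapping.keys (sq_exp w) = w"
  by (auto simp: in_keys_iff lookup_sq_exp split: if_splits)

lemma mdeg_sq_exp: "finite w \<Longrightarrow> mdeg (sq_exp w) = card w"
  by (simp add: mdeg_def keys_sq_exp lookup_sq_exp)

lemma keys_add_expo: "Poly_Mapping.keys (\<alpha> + \<beta> :: expo) = Poly_Mapping.keys \<alpha> \<union> Poly_Mapping.keys \<beta>"
  by (auto simp: in_keys_iff lookup_add)

lemma sq_exp_in_expos: "w \<subseteq> {1..n} \<Longrightarrow> sq_exp w \<in> expos n"
  using finite_subset[of w "{1..n}"] by (simp add: expos_def keys_sq_exp)

lemma up_closed_sq_set: "up_closed n (sq_set n F)"
  unfolding up_closed_def sq_set_def by (auto simp: expos_add keys_add_expo)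

lemma sq_set_insert:
  assumes u: "u \<subseteq> {1..n}"
  shows "sq_set n (insert u F) = sq_set n F \<union> (+) (sq_exp u) ` expos n"
proof -
  have fu: "finite u" using u finite_subset by blast
  have "\<alpha> \<in> (+) (sq_exp u) ` expos n \<longleftrightarrow> u \<subseteq> Poly_Mapping.keys \<alpha>" if \<alpha>: "\<alpha> \<in> expos n" for \<alpha>
  proof
    assume *: "u \<subseteq> Poly_Mapping.keys \<alpha>"
    have "\<alpha> = sq_exp u + (\<alpha> - sq_exp u)"
    proof (rule poly_mapping_eqI)
      fix k
      have "k \<in> u \<Longrightarrow> Poly_Mapping.lookup \<alpha> k \<noteq> 0" using * by (auto simp: in_keys_iff)
      then show "Poly_Mapping.lookup \<alpha> k = Poly_Mapping.lookup (sq_exp u + (\<alpha> - sq_exp u)) k"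
        by (auto simp: lookup_add lookup_minus lookup_sq_exp[OF fu])
    qed
    moreover have "\<alpha> - sq_exp u \<in> expos n"
      using \<alpha> by (auto simp: expos_def in_keys_iff lookup_minus subset_iff)
    ultimately show "\<alpha> \<in> (+) (sq_exp u) ` expos n" by (rule image_eqI)
  qed (auto simp: keys_add_expo keys_sq_exp fu)
  moreover have "(+) (sq_exp u) ` expos n \<subseteq> expos n"
    using expos_add[OF sq_exp_in_expos[OF u]] by blast
  ultimately show ?thesis unfolding sq_set_def by blast
qed

lemma sq_set_colon:
  assumes u: "u \<subseteq> {1..n}"
  shows "{\<alpha> \<in> expos n. sq_exp u + \<alpha> \<in> sq_set n F} = sq_set n ((\<lambda>w. w - u) ` F)"
proof -
  have fu: "finite u" using u finite_subset by blast
  have "w \<subseteq> u \<union> A \<longleftrightarrow> w - u \<subseteq> A" for w A by blast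
  then show ?thesis
    by (auto simp: sq_set_def keys_add_expo keys_sq_exp[OF fu] expos_add[OF sq_exp_in_expos[OF u]])
qed

lemma sq_set_eqI:
  assumes "\<And>w. w \<in> F \<Longrightarrow> \<exists>v\<in>G. v \<subseteq> w" "\<And>v. v \<in> G \<Longrightarrow> \<exists>w\<in>F. w \<subseteq> v"
  shows "sq_set n F = sq_set n G"
  unfolding sq_set_def using assms by (meson order_trans)

lemma has_reg_principal:
  assumes u: "u \<subseteq> {1..n}"
  shows "has_reg n (sq_ideal n {u} :: ('k::field) mpoly set) (int (card u))"
proof -
  have fu: "finite u" using u finite_subset by blast
  have "sq_set n {u} = (+) (sq_exp u) ` expos n"
    using sq_set_insert[OF u, of "{}"] by (simp add: sq_set_def)
  then show ?thesis
    using has_reg_monomial_times[OF up_closed_expos sq_exp_in_expos[OF u] has_reg_poly_ring, where ?'k = 'k]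
    by (simp add: mdeg_sq_exp[OF fu])
qed

text \<open>
  The inductive step for all regularity computations below. The family \<open>C\<close> is any convenient set of
  generators of the colon ideal, whose generators \<open>w - u\<close> are highly redundant in practice.
\<close>

lemma has_reg_insert:
  assumes u: "u \<subseteq> {1..n}"
    and C: "sq_set n ((\<lambda>w. w - u) ` F) = sq_set n C"
    and s: "has_reg n (sq_ideal n C :: ('k::field) mpoly set) s" "1 \<le> s"
    and r: "has_reg n (sq_ideal n F :: 'k mpoly set) r" "r \<le> int (card u) + s - 1"
  shows "has_reg n (sq_ideal n (insert u F) :: 'k mpoly set) (int (card u) + s - 1)"
proof -
  have m: "mdeg (sq_exp u) = card u" using u finite_subset by (intro mdeg_sq_exp) blast
  have "has_reg n (mspan {\<alpha> \<in> expos n. sq_exp u + \<alpha> \<in> sq_set n F} :: 'k mpoly set) s"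
    using s(1) by (simp add: sq_set_colon[OF u] C)
  from has_reg_add_monomial[OF up_closed_sq_set sq_exp_in_expos[OF u] r(1) this s(2)] r(2)
  show ?thesis by (simp add: m sq_set_insert[OF u])
qed

text \<open>
  If \<open>u\<close> is disjoint from all members of \<open>F\<close>, the colon ideal is the ideal of \<open>F\<close> itself.
\<close>

lemma has_reg_disjoint:
  assumes "finite F" "F \<noteq> {}" "\<And>w. w \<in> F \<Longrightarrow> w \<subseteq> {1..n} \<and> w \<noteq> {}" "pairwise disjnt F"
  shows "has_reg n (sq_ideal n F :: ('k::field) mpoly set) (1 + (\<Sum>w\<in>F. int (card w) - 1))"
  using assms
proof (induction F rule: finite_ne_induct)
  case (singleton u)
  then show ?case using has_reg_principal[of u n] by simp
next
  case (insert u F)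
  let ?r = "1 + (\<Sum>w\<in>F. int (card w) - 1)"
  have card: "1 \<le> int (card w)" if "w \<in> insert u F" for w
  proof -
    have "finite w" "w \<noteq> {}" using insert.prems(1)[OF that] finite_subset by blast+
    then have "card w \<noteq> 0" by simp
    then show ?thesis by simp
  qed
  have u: "u \<subseteq> {1..n}" using insert.prems(1) by blast
  have IH: "has_reg n (sq_ideal n F :: 'k mpoly set) ?r"
    using insert.prems by (intro insert.IH) (auto simp: pairwise_insert)
  have "w - u = w" if "w \<in> F" for w
  proof -
    have "w \<noteq> u" using insert.hyps that by blast
    then have "disjnt w u" using insert.prems(2) that unfolding pairwise_insert by (metis disjnt_sym)
    then show ?thesis by (simp add: disjnt_def Diff_triv)
  qed
  then have img: "(\<lambda>w. w - u) ` F = F" by force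
  have "0 \<le> (\<Sum>w\<in>F. int (card w) - 1)" using card by (intro sum_nonneg) force
  then have "1 \<le> ?r" by simp
  from has_reg_insert[OF u _ IH this IH] card[of u]
  have "has_reg n (sq_ideal n (insert u F) :: 'k mpoly set) (int (card u) + ?r - 1)"
    by (simp add: img)
  moreover have "int (card u) + ?r - 1 = 1 + (\<Sum>w\<in>insert u F. int (card w) - 1)"
    using insert.hyps by (simp add: sum.insert)
  ultimately show ?case by metis
qed

lemma has_reg_variables:
  assumes "Z \<subseteq> {1..n}" "Z \<noteq> {}"
  shows "has_reg n (sq_ideal n ((\<lambda>k. {k}) ` Z) :: ('k::field) mpoly set) 1"
proof -
  have "finite Z" using assms(1) finite_subset by blast
  then have "has_reg n (sq_ideal n ((\<lambda>k. {k}) ` Z) :: 'k mpoly set)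
      (1 + (\<Sum>w\<in>(\<lambda>k. {k}) ` Z. int (card w) - 1))"
    using assms by (intro has_reg_disjoint) (auto simp: pairwise_def disjnt_def)
  moreover have "(\<Sum>w\<in>(\<lambda>k. {k}) ` Z. int (card w) - 1) = 0" by (intro sum.neutral) auto
  ultimately show ?thesis by simp
qed

definition uniform :: "nat \<Rightarrow> nat \<Rightarrow> nat set set \<Rightarrow> bool" where
  "uniform n d F \<longleftrightarrow> (\<forall>w\<in>F. w \<subseteq> {1..n} \<and> card w = d)"

lemma uniformD:
  assumes "uniform n d F" "w \<in> F"
  shows "w \<subseteq> {1..n}" "card w = d" "finite w"
  using assms finite_subset[of w "{1..n}"] unfolding uniform_def by auto

text \<open>
  The generators of a squarefree strongly stable ideal: a variable may be replaced by an earlier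
  one that does not occur yet.
\<close>

definition sq_stable :: "nat set set \<Rightarrow> bool" where
  "sq_stable F \<longleftrightarrow>
     (\<forall>w\<in>F. \<forall>i\<in>w. \<forall>j. 1 \<le> j \<longrightarrow> j < i \<longrightarrow> j \<notin> w \<longrightarrow> insert j (w - {i}) \<in> F)"

text \<open>
  Remove a generator \<open>u\<close> whose indices have the largest sum. The rest is still strongly stable,
  since an exchange lowers the sum and so never produces \<open>u\<close>. The colon ideal is generated by the variables \<open>x\<^sub>j\<close> with
  \<open>j \<notin> u\<close> and \<open>j < i\<close> for some \<open>i \<in> u\<close>: exchanging \<open>i\<close> for \<open>j\<close> in \<open>u\<close> yields \<open>x\<^sub>j\<close>, and
  a generator \<open>w \<noteq> u\<close> without such an index would have larger sum than \<open>u\<close>. Thus the ideal has linear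
  quotients.
\<close>

lemma has_reg_sq_stable:
  assumes "uniform n d F" "sq_stable F" "F \<noteq> {}"
  shows "has_reg n (sq_ideal n F :: ('k::field) mpoly set) (int d)"
  using assms
proof (induction "card F" arbitrary: F rule: less_induct)
  case less
  have F: "w \<subseteq> {1..n}" "card w = d" "finite w" if "w \<in> F" for w
    using uniformD[OF less.prems(1) that] by auto
  have exch: "insert j (w - {i}) \<in> F" if "w \<in> F" "i \<in> w" "1 \<le> j" "j < i" "j \<notin> w" for w i j
    using less.prems(2) that unfolding sq_stable_def by blast
  have "F \<subseteq> Pow {1..n}" using F(1) by blast
  then have fF: "finite F" by (rule finite_subset) simp
  have sum_exch: "\<Sum>(insert j (w - {i})) < \<Sum>w" if "w \<in> F" "i \<in> w" "j < i" "j \<notin> w" for w and i j :: nat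
  proof -
    have "\<Sum>w = i + \<Sum>(w - {i})" using F(3)[OF that(1)] that(2) by (rule sum.remove)
    moreover have "\<Sum>(insert j (w - {i})) = j + \<Sum>(w - {i})"
      using F(3)[OF that(1)] that(4) by (intro sum.insert) auto
    ultimately show ?thesis using that(3) by linarith
  qed
  have "Max ((\<lambda>w. \<Sum>w) ` F) \<in> (\<lambda>w. \<Sum>w) ` F" using fF less.prems(3) by (intro Max_in) auto
  then obtain u where u: "u \<in> F" and Max_u: "Max ((\<lambda>w. \<Sum>w) ` F) = \<Sum>u" by blast
  have u_max: "\<Sum>w \<le> \<Sum>u" if "w \<in> F" for w
    unfolding Max_u[symmetric] using fF that by (intro Max_ge) auto
  let ?G = "F - {u}" and ?Z = "{j\<in>{1..n}. j \<notin> u \<and> (\<exists>i\<in>u. j < i)}"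
  show ?case
  proof (cases "?G = {}")
    case True
    then have "F = {u}" using u by blast
    then show ?thesis using has_reg_principal[OF F(1)[OF u]] F(2)[OF u] by simp
  next
    case False
    have "sq_stable ?G"
      unfolding sq_stable_def
    proof (intro conjI ballI allI impI)
      fix w i j assume w: "w \<in> ?G" "i \<in> w" "1 \<le> j" "j < i" "j \<notin> w"
      have "insert j (w - {i}) \<noteq> u" using sum_exch[of w i j] u_max[of w] w by auto
      then show "insert j (w - {i}) \<in> ?G" using exch[of w i j] w by blast
    qed
    moreover have "uniform n d ?G" using less.prems(1) unfolding uniform_def by blast
    moreover have "card ?G < card F" using fF u by (intro psubset_card_mono) auto
    ultimately have regG: "has_reg n (sq_ideal n ?G :: 'k mpoly set) (int d)"
      using less.hyps False by blast
    have witness: "\<exists>j\<in>?Z. j \<in> w" if w: "w \<in> ?G" for w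
    proof (rule ccontr)
      assume no: "\<not> (\<exists>j\<in>?Z. j \<in> w)"
      have wF: "w \<in> F" "w \<noteq> u" using w by auto
      have gt: "i < j" if "j \<in> w - u" "i \<in> u" for i j
      proof -
        have "j \<in> {1..n}" "i \<noteq> j" using F(1)[OF wF(1)] that by auto
        then show ?thesis using no that by force
      qed
      have c: "card (w - u) = card (u - w)"
        using card_Diff_subset_Int[of w u] card_Diff_subset_Int[of u w] F(2,3) wF(1) u by (simp add: Int_commute)
      have ne: "w - u \<noteq> {}"
      proof
        assume "w - u = {}"
        then have "w \<subseteq> u" by blast
        then show False using card_subset_eq[OF F(3)[OF u]] F(2)[OF u] F(2)[OF wF(1)] wF(2) by metis
      qed
      \<comment> \<open>all elements of \<open>w - u\<close> exceed those of \<open>u - w\<close>, so any bijection between them compares the sums\<close>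
      obtain f where f: "bij_betw f (w - u) (u - w)"
        using finite_same_card_bij[of "w - u" "u - w"] F(3) wF(1) u c by auto
      have "\<Sum>(u - w) = (\<Sum>j\<in>w - u. f j)" using sum.reindex_bij_betw[OF f, of "\<lambda>x. x"] by simp
      also have "\<dots> < \<Sum>(w - u)"
      proof (rule sum_strict_mono)
        show "f j < j" if "j \<in> w - u" for j
          using gt[OF that] bij_betwE[OF f] that by blast
      qed (use F(3)[OF wF(1)] ne in auto)
      finally have "\<Sum>(u - w) < \<Sum>(w - u)" .
      moreover have "\<Sum>w = \<Sum>(w - u) + \<Sum>(w \<inter> u)" "\<Sum>u = \<Sum>(u - w) + \<Sum>(w \<inter> u)"
        using sum.Int_Diff[OF F(3)[OF wF(1)], of "\<lambda>x. x" u] sum.Int_Diff[OF F(3)[OF u], of "\<lambda>x. x" w]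
        by (simp_all add: Int_commute)
      ultimately show False using u_max[OF wF(1)] by linarith
    qed
    have colon: "sq_set n ((\<lambda>w. w - u) ` ?G) = sq_set n ((\<lambda>k. {k}) ` ?Z)"
    proof (rule sq_set_eqI)
      fix v assume "v \<in> (\<lambda>w. w - u) ` ?G"
      then obtain w where "w \<in> ?G" "v = w - u" by blast
      then show "\<exists>z\<in>(\<lambda>k. {k}) ` ?Z. z \<subseteq> v" using witness[of w] by blast
    next
      fix v assume "v \<in> (\<lambda>k. {k}) ` ?Z"
      then obtain j i where j: "v = {j}" "j \<in> {1..n}" "j \<notin> u" "i \<in> u" "j < i" by blast
      let ?w = "insert j (u - {i})"
      have "?w \<in> F" using exch[OF u j(4)] j by simp
      moreover have "?w \<noteq> u" using j(3) by blast
      ultimately show "\<exists>w\<in>(\<lambda>w. w - u) ` ?G. w \<subseteq> v"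
        by (intro bexI[of _ "?w - u"]) (auto simp: j(1))
    qed
    have "?Z \<noteq> {}" using False witness by blast
    then have "has_reg n (sq_ideal n ((\<lambda>k. {k}) ` ?Z) :: 'k mpoly set) 1"
      by (intro has_reg_variables) auto
    from has_reg_insert[OF F(1)[OF u] colon this _ regG]
    have "has_reg n (sq_ideal n (insert u ?G) :: 'k mpoly set) (int d)"
      by (simp add: F(2)[OF u])
    moreover have "insert u ?G = F" using u by blast
    ultimately show ?thesis by simp
  qed
qed

section \<open>Gradient ideals\<close>

definition sq_monos :: "nat set set \<Rightarrow> ('k::field) mpoly set" where
  "sq_monos F = (\<lambda>w. Poly_Mapping.single (sq_exp w) 1) ` F"

definition deletions :: "nat set set \<Rightarrow> nat set set" where
  "deletions F = {w - {v} | w v. w \<in> F \<and> v \<in> w}"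

lemma single_in_mspan_iff: "Poly_Mapping.single \<alpha> (1::'k::field) \<in> mspan U \<longleftrightarrow> \<alpha> \<in> U"
  by (simp add: mspan_def)

lemma single_one_inject:
  "Poly_Mapping.single (\<alpha> :: expo) (1::'k::field) = Poly_Mapping.single \<beta> 1 \<longleftrightarrow> \<alpha> = \<beta>"
  using single_in_mspan_iff[of \<alpha> "{\<beta>}", where ?'k = 'k] single_in_mspan_iff[of \<beta> "{\<beta>}", where ?'k = 'k]
  by auto

lemma Idl_sq_monos:
  assumes F: "\<And>w. w \<in> F \<Longrightarrow> w \<subseteq> {1..n}"
  shows "Idl\<^bsub>poly_ring n\<^esub> (sq_monos F :: ('k::field) mpoly set) = sq_ideal n F"
proof -
  have "sq_set n F = (\<Union>w\<in>F. sq_set n {w})" by (auto simp: sq_set_def)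
  also have "\<dots> = (\<Union>w\<in>F. (+) (sq_exp w) ` expos n)"
    using sq_set_insert[OF F, where F = "{}"] by (simp add: sq_set_def)
  also have "\<dots> = up_set n (sq_exp ` F)" unfolding up_set_def by blast
  finally have eq: "up_set n (sq_exp ` F) = sq_set n F" ..
  have "sq_exp ` F \<subseteq> expos n" using sq_exp_in_expos[OF F] by blast
  from Idl_monomials[OF this, where ?'k = 'k] show ?thesis
    by (simp add: eq sq_monos_def image_image)
qed

lemma mdeg_eq_0: "mdeg \<beta> = 0 \<longleftrightarrow> \<beta> = 0"
proof
  assume "mdeg \<beta> = 0"
  then have "\<forall>k\<in>Poly_Mapping.keys \<beta>. Poly_Mapping.lookup \<beta> k = 0" unfolding mdeg_def by simp
  then have "Poly_Mapping.lookup \<beta> k = 0" for k by (cases "k \<in> Poly_Mapping.keys \<beta>") (simp_all add: in_keys_iff)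
  then show "\<beta> = 0" by (intro poly_mapping_eqI) simp
qed (simp add: mdeg_def)

lemma card_keys_le_mdeg: "card (Poly_Mapping.keys \<alpha>) \<le> mdeg \<alpha>"
proof -
  have "(\<Sum>k\<in>Poly_Mapping.keys \<alpha>. 1) \<le> (\<Sum>k\<in>Poly_Mapping.keys \<alpha>. Poly_Mapping.lookup \<alpha> k)"
    by (rule sum_mono) (simp add: in_keys_iff)
  then show ?thesis by (simp add: mdeg_def)
qed

lemma sq_set_mdeg:
  assumes "uniform n d F" "\<alpha> \<in> sq_set n F"
  shows "d \<le> mdeg \<alpha>"
proof -
  obtain w where "w \<in> F" "w \<subseteq> Poly_Mapping.keys \<alpha>" using assms(2) by (auto simp: sq_set_def)
  then show ?thesis
    using uniformD(2)[OF assms(1)] card_mono[of "Poly_Mapping.keys \<alpha>" w] card_keys_le_mdeg[of \<alpha>] by fastforce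
qed

lemma sq_exp_in_sq_set: "w \<in> F \<Longrightarrow> w \<subseteq> {1..n} \<Longrightarrow> sq_exp w \<in> sq_set n F"
  using finite_subset[of w "{1..n}"] by (auto simp: sq_set_def sq_exp_in_expos keys_sq_exp)

lemma minimal_generators_sq_monos:
  assumes F: "uniform n d F"
  shows "minimal_generators n (sq_ideal n F) (sq_monos F :: ('k::field) mpoly set)"
  unfolding minimal_generators_def
proof (intro conjI allI impI)
  show "sq_monos F \<subseteq> carrier (poly_ring n :: 'k mpoly ring)"
    unfolding sq_monos_def by (intro image_subsetI single_in_carrier sq_exp_in_expos uniformD[OF F])
  show "Idl\<^bsub>poly_ring n\<^esub> (sq_monos F :: 'k mpoly set) = sq_ideal n F"
    using F by (intro Idl_sq_monos uniformD(1))
  fix H :: "'k mpoly set" assume H: "H \<subset> sq_monos F"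
  define E where "E = {w \<in> F. Poly_Mapping.single (sq_exp w) 1 \<in> H}"
  have HE: "H = sq_monos E" using H unfolding E_def sq_monos_def by blast
  have EF: "E \<subseteq> F" unfolding E_def by blast
  obtain w where w: "w \<in> F" "w \<notin> E" using H EF unfolding HE sq_monos_def by blast
  show "Idl\<^bsub>poly_ring n\<^esub> H \<noteq> sq_ideal n F"
  proof
    assume "Idl\<^bsub>poly_ring n\<^esub> H = sq_ideal n F"
    moreover have "Idl\<^bsub>poly_ring n\<^esub> H = sq_ideal n E"
      unfolding HE using F EF by (intro Idl_sq_monos uniformD(1)[OF F]) blast
    moreover have "sq_exp w \<in> sq_set n F" using uniformD(1)[OF F] w by (intro sq_exp_in_sq_set) auto
    ultimately have "sq_exp w \<in> sq_set n E" using single_in_mspan_iff[where ?'k = 'k] by blast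
    moreover have fw: "finite w" by (rule uniformD(3)[OF F w(1)])
    ultimately obtain v where v: "v \<in> E" "v \<subseteq> w" by (auto simp: sq_set_def keys_sq_exp)
    then have "v = w" using card_subset_eq[OF fw v(2)] uniformD(2)[OF F] w(1) EF by auto
    then show False using v w by simp
  qed
qed

text \<open>
  A monomial generating set must contain, for every \<open>w \<in> F\<close>, a divisor of \<open>x\<^sup>w\<close>. No monomial of the
  ideal has degree less than \<open>d\<close>, so the divisor is \<open>x\<^sup>w\<close> itself.
\<close>

lemma mono_gens_sq_ideal:
  assumes F: "uniform n d F"
  shows "mono_gens n (sq_ideal n F) = (sq_monos F :: ('k::field) mpoly set)"
  unfolding mono_gens_def
proof (rule the_equality)
  have "sq_exp ` F \<subseteq> expos n" by (intro image_subsetI sq_exp_in_expos uniformD[OF F])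
  then show "minimal_generators n (sq_ideal n F) (sq_monos F :: 'k mpoly set) \<and> sq_monos F \<subseteq> monomials n"
    using minimal_generators_sq_monos[OF F] unfolding sq_monos_def monomials_def by blast
  fix G :: "'k mpoly set" assume G: "minimal_generators n (sq_ideal n F) G \<and> G \<subseteq> monomials n"
  define A where "A = {\<alpha> \<in> expos n. Poly_Mapping.single \<alpha> (1::'k) \<in> G}"
  have GA: "G = (\<lambda>\<alpha>. Poly_Mapping.single \<alpha> 1) ` A" using G unfolding A_def monomials_def by blast
  have A: "A \<subseteq> expos n" unfolding A_def by blast
  have IA: "mspan (up_set n A) = (sq_ideal n F :: 'k mpoly set)"
    using G Idl_monomials[OF A, where ?'k = 'k] by (simp add: minimal_generators_def GA)
  then have UA: "up_set n A = sq_set n F" using single_in_mspan_iff[where ?'k = 'k] by blast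
  have "sq_exp w \<in> A" if w: "w \<in> F" for w
  proof -
    have "sq_exp w \<in> up_set n A" unfolding UA using uniformD(1)[OF F] w by (intro sq_exp_in_sq_set) auto
    then obtain \<alpha> \<beta> where ab: "sq_exp w = \<alpha> + \<beta>" "\<alpha> \<in> A" unfolding up_set_def by blast
    have "\<alpha> + 0 \<in> up_set n A" using ab(2) zero_in_expos unfolding up_set_def by blast
    then have "d \<le> mdeg \<alpha>" unfolding UA using sq_set_mdeg[OF F] by simp
    moreover have "mdeg (sq_exp w) = d" using uniformD[OF F w] by (simp add: mdeg_sq_exp)
    ultimately have "mdeg \<beta> = 0" using mdeg_add[of \<alpha> \<beta>] ab(1) by simp
    then show ?thesis using ab by (simp add: mdeg_eq_0)
  qed
  then have "sq_monos F \<subseteq> G" unfolding GA sq_monos_def by blast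
  moreover have "Idl\<^bsub>poly_ring n\<^esub> (sq_monos F :: 'k mpoly set) = sq_ideal n F"
    using F by (intro Idl_sq_monos uniformD(1))
  ultimately show "G = sq_monos F" using G unfolding minimal_generators_def by blast
qed

lemma sq_exp_minus_var:
  assumes "finite w"
  shows "sq_exp w - var_exp i = sq_exp (w - {i})"
  by (rule poly_mapping_eqI) (use assms in \<open>auto simp: lookup_minus lookup_sq_exp lookup_var_exp\<close>)

lemma mono_quotients_sq_ideal:
  assumes F: "uniform n d F"
  shows "mono_quotients n (sq_ideal n F) = (sq_monos (deletions F) :: ('k::field) mpoly set)"
proof -
  have fw: "finite w" if "w \<in> F" for w using uniformD(3)[OF F that] .
  have "mono_quotients n (sq_ideal n F) =
      {Poly_Mapping.single (sq_exp w - var_exp i) (1::'k) | w i. w \<in> F \<and> i \<in> Poly_Mapping.keys (sq_exp w)}"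
    unfolding mono_quotients_def mono_gens_sq_ideal[OF F] sq_monos_def image_iff single_one_inject by blast
  also have "\<dots> = {Poly_Mapping.single (sq_exp (w - {i})) (1::'k) | w i. w \<in> F \<and> i \<in> w}"
    using fw keys_sq_exp sq_exp_minus_var by (intro Collect_cong) metis
  also have "\<dots> = sq_monos (deletions F)" unfolding sq_monos_def deletions_def by blast
  finally show ?thesis .
qed

lemma lookup_partial_deriv:
  "Poly_Mapping.lookup (partial_deriv i p) \<beta> =
    of_nat (Poly_Mapping.lookup \<beta> i + 1) * Poly_Mapping.lookup (p :: ('k::field) mpoly) (\<beta> + var_exp i)"
proof -
  let ?g = "\<lambda>\<alpha>. of_nat (Poly_Mapping.lookup \<alpha> i) * Poly_Mapping.lookup p \<alpha>"
  have "Poly_Mapping.lookup (partial_deriv i p) \<beta> = (\<Sum>\<alpha>\<in>Poly_Mapping.keys p. ?g \<alpha> when \<alpha> - var_exp i = \<beta>)"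
    by (simp add: partial_deriv_def lookup_sum lookup_single)
  also have "\<dots> = (\<Sum>\<alpha>\<in>Poly_Mapping.keys p. if \<alpha> = \<beta> + var_exp i then ?g \<alpha> else 0)"
  proof (rule sum.cong)
    fix \<alpha>
    show "(?g \<alpha> when \<alpha> - var_exp i = \<beta>) = (if \<alpha> = \<beta> + var_exp i then ?g \<alpha> else 0)"
    proof (cases "Poly_Mapping.lookup \<alpha> i = 0")
      case False
      then show ?thesis by (simp add: exp_minus_var_eq when_def)
    qed (auto simp: lookup_add lookup_var_exp)
  qed simp
  also have "\<dots> = (if \<beta> + var_exp i \<in> Poly_Mapping.keys p then ?g (\<beta> + var_exp i) else 0)"
    by (rule sum.delta) simp
  also have "\<dots> = of_nat (Poly_Mapping.lookup \<beta> i + 1) * Poly_Mapping.lookup p (\<beta> + var_exp i)"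
    by (simp add: in_keys_iff lookup_add lookup_var_exp)
  finally show ?thesis .
qed

lemma partial_deriv_linear:
  fixes p q :: "('k::field) mpoly"
  shows "partial_deriv i (p + q) = partial_deriv i p + partial_deriv i q"
    and "partial_deriv i (Poly_Mapping.single 0 a * p) = Poly_Mapping.single 0 a * partial_deriv i p"
proof -
  show "partial_deriv i (p + q) = partial_deriv i p + partial_deriv i q"
    by (rule poly_mapping_eqI) (simp only: lookup_partial_deriv lookup_add distrib_left)
  have s: "Poly_Mapping.lookup (Poly_Mapping.single 0 a * r) \<beta> = a * Poly_Mapping.lookup r \<beta>"
    for r :: "'k mpoly" and \<beta>
    using lookup_monomial_times[of 0 a r \<beta>] by simp
  show "partial_deriv i (Poly_Mapping.single 0 a * p) = Poly_Mapping.single 0 a * partial_deriv i p"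
    by (rule poly_mapping_eqI) (simp only: s lookup_partial_deriv mult.left_commute)
qed

text \<open>
  Multiplication by \<open>q\<close> acts on the lowest degree component through the constant term of \<open>q\<close>.
\<close>

lemma lookup_times_lowest_degree:
  fixes p q :: "('k::field) mpoly"
  assumes "\<forall>\<alpha>\<in>Poly_Mapping.keys p. d \<le> mdeg \<alpha>" "mdeg \<delta> = d"
  shows "Poly_Mapping.lookup (q * p) \<delta> = Poly_Mapping.lookup q 0 * Poly_Mapping.lookup p \<delta>"
proof -
  define a where "a = Poly_Mapping.lookup q 0"
  define q' where "q' = q - Poly_Mapping.single 0 a"
  have "Poly_Mapping.lookup (q' * p) \<delta> = 0"
  proof (rule ccontr)
    assume "Poly_Mapping.lookup (q' * p) \<delta> \<noteq> 0"
    then obtain \<gamma> \<alpha> where g: "\<delta> = \<gamma> + \<alpha>" "\<gamma> \<in> Poly_Mapping.keys q'" "\<alpha> \<in> Poly_Mapping.keys p"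
      using Poly_Mapping.keys_mult[of q' p] unfolding in_keys_iff[symmetric] by blast
    have "0 \<notin> Poly_Mapping.keys q'" by (simp add: q'_def a_def in_keys_iff lookup_minus)
    then have "\<gamma> \<noteq> 0" using g(2) by blast
    then have "mdeg \<gamma> \<noteq> 0" by (simp add: mdeg_eq_0)
    then show False using assms(1)[rule_format, OF g(3)] assms(2) by (simp add: g(1) mdeg_add)
  qed
  moreover have "q = Poly_Mapping.single 0 a + q'" by (simp add: q'_def)
  then have "q * p = Poly_Mapping.single 0 a * p + q' * p" by (simp only: distrib_right)
  moreover have "Poly_Mapping.lookup (Poly_Mapping.single 0 a * p) \<delta> = a * Poly_Mapping.lookup p \<delta>"
    using lookup_monomial_times[of 0 a p \<delta>] by simp
  ultimately show ?thesis by (simp add: lookup_add a_def)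
qed

text \<open>
  Let \<open>J\<close> be the ideal generated by the derivatives of \<open>G\<close>. For one inclusion, a monomial \<open>x\<^sup>\<beta>\<close> of
  \<open>\<partial>f/\<partial>x\<^sub>i\<close> comes from a monomial of \<open>f\<close> divisible by some \<open>x\<^sup>w\<close>, and losing one factor \<open>x\<^sub>i\<close> leaves a multiple of
  \<open>x\<^bsup>w - {v}\<^esup>\<close> for some \<open>v \<in> w\<close>. For the other one, consider all polynomials without terms of degree
  below \<open>d\<close> for which the derivatives of the degree \<open>d\<close> component lie in \<open>J\<close>. They form an ideal,
  since that component is only multiplied by constants; this ideal contains \<open>G\<close>, as \<open>G\<close> is homogeneous,
  and hence contains every generator \<open>x\<^sup>w\<close>, whose derivative \<open>x\<^bsup>w - {v}\<^esup>\<close> has coefficient \<open>1\<close>.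
\<close>

lemma Idl_partial_derivs:
  fixes G :: "('k::field) mpoly set"
  assumes F: "uniform n d F" and d: "0 < d"
    and G: "G \<subseteq> carrier (poly_ring n)" "Idl\<^bsub>poly_ring n\<^esub> G = sq_ideal n F" "\<forall>f\<in>G. \<exists>e. homog e f"
  shows "Idl\<^bsub>poly_ring n\<^esub> {partial_deriv i f | i f. i \<in> {1..n} \<and> f \<in> G} = sq_ideal n (deletions F)"
    (is "Idl\<^bsub>?R\<^esub> ?D = _")
proof
  interpret R: cring "?R :: 'k mpoly ring" by (rule poly_ring_cring)
  have GI: "f \<in> sq_ideal n F" if "f \<in> G" for f
    using R.genideal_self[OF G(1)] that G(2) by blast
  have D_sub: "?D \<subseteq> sq_ideal n (deletions F)"
  proof clarify
    fix i f assume i: "i \<in> {1..n}" and f: "f \<in> G"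
    have "\<beta> \<in> sq_set n (deletions F)" if "\<beta> \<in> Poly_Mapping.keys (partial_deriv i f)" for \<beta>
    proof -
      have "Poly_Mapping.lookup f (\<beta> + var_exp i) \<noteq> 0"
        using that unfolding in_keys_iff lookup_partial_deriv by (metis mult_zero_right)
      then have "\<beta> + var_exp i \<in> sq_set n F" using GI[OF f] unfolding mspan_def in_keys_iff[symmetric] by blast
      then obtain w where w: "w \<in> F" "w \<subseteq> insert i (Poly_Mapping.keys \<beta>)" and e: "\<beta> \<in> expos n"
        by (auto simp: sq_set_def keys_add_var expos_def)
      have "w \<noteq> {}" using uniformD(2)[OF F w(1)] d by auto
      then obtain v where v: "v \<in> w" "i \<in> w \<Longrightarrow> v = i" by blast
      have "w - {v} \<subseteq> Poly_Mapping.keys \<beta>" using w(2) v by blast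
      then show ?thesis using e w(1) v(1) unfolding sq_set_def deletions_def by blast
    qed
    then show "partial_deriv i f \<in> sq_ideal n (deletions F)" by (auto simp: mspan_def)
  qed
  then show "Idl\<^bsub>?R\<^esub> ?D \<subseteq> sq_ideal n (deletions F)"
    by (intro R.genideal_minimal mspan_ideal up_closed_sq_set)
  have "sq_ideal n (deletions F) \<subseteq> carrier ?R"
    by (auto simp: mspan_def sq_set_def poly_ring_carrier_iff)
  then have D: "?D \<subseteq> carrier ?R" using D_sub by blast
  let ?J = "Idl\<^bsub>?R\<^esub> ?D"
  have J: "ideal ?J ?R" by (rule R.genideal_ideal[OF D])
  have J0: "0 \<in> ?J" using ideal_sum_closed[OF J, of "{}"] by simp
  have Jadd: "p + q \<in> ?J" if "p \<in> ?J" "q \<in> ?J" for p q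
    using additive_subgroup.a_closed[OF ideal.axioms(1)[OF J] that] by simp
  define low :: "'k mpoly \<Rightarrow> 'k mpoly" where "low = restrict_keys {\<alpha>. mdeg \<alpha> = d}"
  have lookup_low: "Poly_Mapping.lookup (low p) \<delta> = (if mdeg \<delta> = d then Poly_Mapping.lookup p \<delta> else 0)"
    for p :: "'k mpoly" and \<delta> by (simp add: low_def lookup_restrict_keys)
  \<comment> \<open>the auxiliary ideal through which membership passes from \<open>G\<close> to the monomial generators\<close>
  define L where "L = {p \<in> carrier ?R. (\<forall>\<alpha>\<in>Poly_Mapping.keys p. d \<le> mdeg \<alpha>) \<and>
    (\<forall>i\<in>{1..n}. partial_deriv i (low p) \<in> ?J)}"
  have deriv0: "partial_deriv i (0 :: 'k mpoly) = 0" for i by (simp add: partial_deriv_def)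
  have "ideal L ?R"
  proof (rule poly_ring_idealI)
    show "L \<subseteq> carrier ?R" unfolding L_def by blast
    have "low 0 = 0" by (rule poly_mapping_eqI) (simp add: lookup_low)
    then show "0 \<in> L" using J0 by (simp add: L_def poly_ring_closed deriv0)
  next
    fix p q assume p: "p \<in> L" and q: "q \<in> L"
    have "low (p + q) = low p + low q" by (rule poly_mapping_eqI) (simp add: lookup_low lookup_add)
    moreover have "d \<le> mdeg \<alpha>" if "\<alpha> \<in> Poly_Mapping.keys (p + q)" for \<alpha>
      using p q that Poly_Mapping.keys_add[of p q] unfolding L_def by blast
    moreover have "p + q \<in> carrier ?R" using p q unfolding L_def by (blast intro: poly_ring_closed)
    ultimately show "p + q \<in> L" using p q Jadd by (simp add: L_def partial_deriv_linear)
  next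
    fix p q assume p: "p \<in> L" and q: "q \<in> carrier ?R"
    have pd: "\<forall>\<alpha>\<in>Poly_Mapping.keys p. d \<le> mdeg \<alpha>" using p unfolding L_def by blast
    have c: "Poly_Mapping.single 0 a \<in> carrier ?R" for a :: 'k by (simp add: single_in_carrier)
    have "low (q * p) = Poly_Mapping.single 0 (Poly_Mapping.lookup q 0) * low p"
    proof (rule poly_mapping_eqI)
      fix \<delta>
      show "Poly_Mapping.lookup (low (q * p)) \<delta> =
          Poly_Mapping.lookup (Poly_Mapping.single 0 (Poly_Mapping.lookup q 0) * low p) \<delta>"
        using lookup_monomial_times[of 0 "Poly_Mapping.lookup q 0" "low p" \<delta>]
          lookup_times_lowest_degree[OF pd, of \<delta> q] by (simp add: lookup_low)
    qed
    then have "partial_deriv i (low (q * p)) \<in> ?J" if "i \<in> {1..n}" for i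
      using p that c ideal_mult_closed[OF J] by (simp add: L_def partial_deriv_linear)
    moreover have "d \<le> mdeg \<alpha>" if "\<alpha> \<in> Poly_Mapping.keys (q * p)" for \<alpha>
    proof -
      obtain \<beta> \<gamma> where "\<alpha> = \<beta> + \<gamma>" "\<gamma> \<in> Poly_Mapping.keys p"
        using \<open>\<alpha> \<in> _\<close> Poly_Mapping.keys_mult[of q p] by blast
      then show ?thesis using pd by (fastforce simp: mdeg_add)
    qed
    moreover have "q * p \<in> carrier ?R" using p q unfolding L_def by (blast intro: poly_ring_closed)
    ultimately show "q * p \<in> L" by (simp add: L_def)
  qed
  moreover have "G \<subseteq> L"
  proof
    fix f assume f: "f \<in> G"
    have fd: "d \<le> mdeg \<alpha>" if "\<alpha> \<in> Poly_Mapping.keys f" for \<alpha>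
      using GI[OF f] that by (intro sq_set_mdeg[OF F]) (auto simp: mspan_def)
    obtain e where e: "homog e f" using G(3) f by blast
    have "low f = (if e = int d then f else 0)"
    proof (rule poly_mapping_eqI)
      fix \<delta>
      show "Poly_Mapping.lookup (low f) \<delta> = Poly_Mapping.lookup (if e = int d then f else 0) \<delta>"
        using e by (cases "Poly_Mapping.lookup f \<delta> = 0") (auto simp: lookup_low homog_def in_keys_iff)
    qed
    moreover have "partial_deriv i f \<in> ?J" if "i \<in> {1..n}" for i
      using R.genideal_self[OF D] that f by blast
    ultimately show "f \<in> L" using G(1) f fd J0 by (auto simp: L_def deriv0)
  qed
  ultimately have IL: "sq_ideal n F \<subseteq> L" using R.genideal_minimal G(2) by blast
  have "sq_monos (deletions F) \<subseteq> ?J"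
  proof
    fix x :: "'k mpoly" assume "x \<in> sq_monos (deletions F)"
    then obtain w v where w: "w \<in> F" "v \<in> w" and x: "x = Poly_Mapping.single (sq_exp (w - {v})) 1"
      unfolding sq_monos_def deletions_def by blast
    have fw: "finite w" and v: "v \<in> {1..n}" using uniformD[OF F w(1)] w(2) by auto
    let ?m = "Poly_Mapping.single (sq_exp w) 1 :: 'k mpoly"
    have "?m \<in> sq_ideal n F"
      unfolding single_in_mspan_iff using uniformD(1)[OF F w(1)] w(1) by (intro sq_exp_in_sq_set)
    then have "partial_deriv v (low ?m) \<in> ?J" using IL v unfolding L_def by blast
    moreover have "low ?m = ?m"
      by (rule poly_mapping_eqI)
        (use uniformD(2)[OF F w(1)] fw in \<open>auto simp: lookup_low lookup_single when_def mdeg_sq_exp\<close>)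
    moreover have "partial_deriv v ?m = x"
      by (simp add: partial_deriv_def x lookup_sq_exp[OF fw] w(2) sq_exp_minus_var[OF fw])
    ultimately show "x \<in> ?J" by simp
  qed
  then have "Idl\<^bsub>?R\<^esub> (sq_monos (deletions F)) \<subseteq> ?J" by (intro R.genideal_minimal J)
  moreover have "Idl\<^bsub>?R\<^esub> (sq_monos (deletions F) :: 'k mpoly set) = sq_ideal n (deletions F)"
    using uniformD(1)[OF F] by (intro Idl_sq_monos) (auto simp: deletions_def)
  ultimately show "sq_ideal n (deletions F) \<subseteq> ?J" by simp
qed

text \<open>
  The gradient ideal does not depend on the homogeneous minimal generating set that is chosen, so it
  can be compared with the ideal of all quotients \<open>u / x\<^sub>i\<close>.
\<close>

lemma gradient_sq_ideal:
  assumes F: "uniform n d F" and d: "0 < d"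
  shows "gradient_ideal n (sq_ideal n F) = (sq_ideal n (deletions F) :: ('k::field) mpoly set)"
    and "char_suitable n (sq_ideal n F :: 'k mpoly set)"
    and "monomial_ideal n (sq_ideal n F :: 'k mpoly set)"
proof -
  let ?P = "\<lambda>G. minimal_generators n (sq_ideal n F) G \<and> (\<forall>f\<in>G. \<exists>e. homog e (f :: 'k mpoly))"
  have "\<exists>e. homog e f" if "f \<in> sq_monos F" for f :: "'k mpoly"
  proof -
    obtain w where "f = Poly_Mapping.single (sq_exp w) 1" using \<open>f \<in> _\<close> unfolding sq_monos_def by blast
    then have "homog (int (mdeg (sq_exp w))) f" by (simp add: homog_def)
    then show ?thesis by blast
  qed
  then have "?P (sq_monos F)" using minimal_generators_sq_monos[OF F, where ?'k = 'k] by blast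
  then have "?P (SOME G. ?P G)" by (rule someI)
  then show grad: "gradient_ideal n (sq_ideal n F) = (sq_ideal n (deletions F) :: 'k mpoly set)"
    unfolding gradient_ideal_def Let_def minimal_generators_def
    by (intro Idl_partial_derivs[OF F d]) blast+
  have "Idl\<^bsub>poly_ring n\<^esub> (sq_monos (deletions F) :: 'k mpoly set) = sq_ideal n (deletions F)"
    using uniformD(1)[OF F] by (intro Idl_sq_monos) (auto simp: deletions_def)
  then show "char_suitable n (sq_ideal n F :: 'k mpoly set)"
    unfolding char_suitable_def grad mono_quotients_sq_ideal[OF F] by simp
  have "Idl\<^bsub>poly_ring n\<^esub> (sq_monos F :: 'k mpoly set) = sq_ideal n F"
    using F by (intro Idl_sq_monos uniformD(1))
  moreover have "sq_monos F \<subseteq> (monomials n :: 'k mpoly set)"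
    unfolding sq_monos_def monomials_def by (auto intro!: imageI sq_exp_in_expos uniformD(1)[OF F])
  ultimately show "monomial_ideal n (sq_ideal n F :: 'k mpoly set)"
    unfolding monomial_ideal_def by metis
qed

lemma sq_ideal_neq_0:
  assumes "w \<in> F" "w \<subseteq> {1..n}"
  shows "(sq_ideal n F :: ('k::field) mpoly set) \<noteq> {0}"
proof
  assume z: "(sq_ideal n F :: 'k mpoly set) = {0}"
  have "Poly_Mapping.single (sq_exp w) (1::'k) \<in> sq_ideal n F"
    unfolding single_in_mspan_iff by (rule sq_exp_in_sq_set[OF assms])
  then have "Poly_Mapping.single (sq_exp w) (1::'k) = 0" unfolding z by blast
  then show False by (metis lookup_single_eq lookup_zero zero_neq_one)
qed

lemma regularity_difference_witness:
  assumes F: "uniform n d F" and "0 < d" "F \<noteq> {}" "0 < n"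
    and r: "has_reg n (sq_ideal n F :: ('k::field) mpoly set) r"
    and s: "has_reg n (sq_ideal n (deletions F) :: 'k mpoly set) s"
  shows "\<exists>(n::nat) (I :: 'k mpoly set). n > 0 \<and> monomial_ideal n I \<and> char_suitable n I \<and>
    I \<noteq> {0} \<and> gradient_ideal n I \<noteq> {0} \<and> regularity n I - regularity n (gradient_ideal n I) = r - s"
proof (intro exI conjI)
  let ?I = "sq_ideal n F :: 'k mpoly set"
  note grad = gradient_sq_ideal[OF F \<open>0 < d\<close>, where ?'k = 'k]
  obtain w where w: "w \<in> F" using \<open>F \<noteq> {}\<close> by blast
  then obtain v where v: "v \<in> w" using uniformD(2)[OF F w] \<open>0 < d\<close> by fastforce
  show "monomial_ideal n ?I" "char_suitable n ?I" by (fact grad)+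
  show "?I \<noteq> {0}" using uniformD(1)[OF F w] w by (intro sq_ideal_neq_0[of w])
  have "w - {v} \<in> deletions F" unfolding deletions_def using w v by blast
  then show "gradient_ideal n ?I \<noteq> {0}"
    unfolding grad using uniformD(1)[OF F w] by (intro sq_ideal_neq_0[of "w - {v}"]) auto
  show "regularity n ?I - regularity n (gradient_ideal n ?I) = r - s"
    unfolding grad by (simp add: regularity_eqI[OF up_closed_sq_set r] regularity_eqI[OF up_closed_sq_set s])
qed (fact \<open>0 < n\<close>)

section \<open>Ideals realizing every difference\<close>

lemma positive_differences:
  assumes "0 < a"
  shows "\<exists>(n::nat) (I :: ('k::field) mpoly set). n > 0 \<and> monomial_ideal n I \<and> char_suitable n I \<and>
    I \<noteq> {0} \<and> gradient_ideal n I \<noteq> {0} \<and> regularity n I - regularity n (gradient_ideal n I) = int a"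
proof -
  let ?n = "2 * a"
  define p where "p k = {k, a + k}" for k
  let ?F = "p ` {1..a}"
  have inj: "inj_on p {1..a}" by (auto simp: inj_on_def p_def doubleton_eq_iff)
  have card: "card (p k) = 2" if "k \<in> {1..a}" for k
    using \<open>0 < a\<close> by (simp add: p_def)
  have F: "uniform ?n 2 ?F" unfolding uniform_def using card by (auto simp: p_def)
  have "(\<Sum>w\<in>?F. int (card w) - 1) = (\<Sum>k\<in>{1..a}. int (card (p k)) - 1)"
    by (simp only: sum.reindex[OF inj] o_def)
  also have "\<dots> = (\<Sum>k\<in>{1..a}. 1)" using card by (intro sum.cong refl) fastforce
  finally have s: "(\<Sum>w\<in>?F. int (card w) - 1) = int a" by simp
  have "has_reg ?n (sq_ideal ?n ?F :: 'k mpoly set) (1 + (\<Sum>w\<in>?F. int (card w) - 1))"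
    using \<open>0 < a\<close> by (intro has_reg_disjoint) (auto simp: p_def pairwise_def disjnt_def)
  then have r: "has_reg ?n (sq_ideal ?n ?F :: 'k mpoly set) (1 + int a)" by (simp only: s)
  have del: "deletions ?F = (\<lambda>k. {k}) ` {1..2 * a}"
  proof
    show "deletions ?F \<subseteq> (\<lambda>k. {k}) ` {1..2 * a}" by (auto simp: deletions_def p_def)
    show "(\<lambda>k. {k}) ` {1..2 * a} \<subseteq> deletions ?F"
    proof clarify
      fix k assume k: "k \<in> {1..2 * a}"
      show "{k} \<in> deletions ?F"
      proof (cases "k \<le> a")
        case True
        then have "p k \<in> ?F" "a + k \<in> p k" "{k} = p k - {a + k}" using k \<open>0 < a\<close> by (auto simp: p_def)
        then show ?thesis unfolding deletions_def by blast
      next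
        case False
        then have "k - a \<in> {1..a}" "p (k - a) = {k - a, k}" using k by (auto simp: p_def)
        moreover from this have "k - a \<in> p (k - a)" "{k} = p (k - a) - {k - a}" using \<open>0 < a\<close> False by auto
        ultimately have "p (k - a) \<in> ?F" "k - a \<in> p (k - a)" "{k} = p (k - a) - {k - a}" by blast+
        then show ?thesis unfolding deletions_def by blast
      qed
    qed
  qed
  have "has_reg ?n (sq_ideal ?n (deletions ?F) :: 'k mpoly set) 1"
    unfolding del using \<open>0 < a\<close> by (intro has_reg_variables) auto
  from regularity_difference_witness[OF F _ _ _ r this] \<open>0 < a\<close> show ?thesis by simp
qed

text \<open>
  The sets of size \<open>d\<close> with at most one element outside the core \<open>{1..m}\<close>. With \<open>n = 3m\<close>, the core
  stands for the variables \<open>x\<^sub>k\<close>, and \<open>m + k\<close> and \<open>2m + k\<close> stand for \<open>y\<^sub>k\<close> and \<open>z\<^sub>k\<close>. The case \<open>d = 3\<close> enters \<open>I\<close>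
  and the case \<open>d = 2\<close> enters its gradient ideal.
\<close>

definition core_sets :: "nat \<Rightarrow> nat \<Rightarrow> nat \<Rightarrow> nat set set" where
  "core_sets n m d = {w. w \<subseteq> {1..n} \<and> card w = d \<and> d \<le> card (w \<inter> {1..m}) + 1}"

lemma uniform_core_sets: "uniform n d (core_sets n m d)"
  by (simp add: uniform_def core_sets_def)

lemma sq_stable_core_sets: "sq_stable (core_sets n m d)"
  unfolding sq_stable_def
proof (intro ballI allI impI)
  fix w i j assume w: "w \<in> core_sets n m d" and ij: "i \<in> w" "1 \<le> j" "j < i" "j \<notin> w"
  let ?v = "insert j (w - {i})" and ?M = "{1..m}"
  have wn: "w \<subseteq> {1..n}" "card w = d" "d \<le> card (w \<inter> ?M) + 1" using w by (auto simp: core_sets_def)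
  have fw: "finite w" using wn(1) finite_subset by blast
  have "?v \<subseteq> {1..n}" using wn(1) ij by auto
  moreover have "card ?v = card w" using fw ij card_Suc_Diff1[OF fw ij(1)] by simp
  moreover have "card (w \<inter> ?M) \<le> card (?v \<inter> ?M)"
  proof (cases "i \<le> m")
    case True
    then have eq: "?v \<inter> ?M = insert j ((w \<inter> ?M) - {i})" and i: "i \<in> w \<inter> ?M" using wn(1) ij by auto
    show ?thesis using fw ij card_Suc_Diff1[OF _ i] unfolding eq by simp
  next
    case False
    then show ?thesis using fw by (intro card_mono) auto
  qed
  ultimately show "?v \<in> core_sets n m d" using wn by (simp add: core_sets_def)
qed

lemma has_reg_core_sets:
  assumes "F = core_sets n m d" "F \<noteq> {}"
  shows "has_reg n (sq_ideal n F :: ('k::field) mpoly set) (int d)"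
  using has_reg_sq_stable[OF uniform_core_sets sq_stable_core_sets] assms by blast

lemma in_core_sets_2: "w \<in> core_sets n m 2 \<longleftrightarrow> w \<subseteq> {1..n} \<and> card w = 2 \<and> (\<exists>j\<in>w. j \<in> {1..m})"
proof -
  have "2 \<le> card (w \<inter> {1..m}) + 1 \<longleftrightarrow> w \<inter> {1..m} \<noteq> {}"
    using card_gt_0_iff[of "w \<inter> {1..m}"] by auto
  then show ?thesis unfolding core_sets_def by blast
qed

text \<open>
  Adding the triple \<open>{k, m + k, 2m + k}\<close> with \<open>k = i + 1\<close> keeps the regularity: every other generator
  meets the core outside \<open>k\<close>, and conversely \<open>{k, j, m + k}\<close> is a generator for each \<open>j \<noteq> k\<close> in the core, so the
  colon ideal is generated by the core variables other than \<open>x\<^sub>k\<close>. There is one because \<open>m \<ge> 2\<close>.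
\<close>

lemma has_reg_triples:
  assumes m: "2 \<le> m" and i: "i \<le> m"
  shows "has_reg (3 * m) (sq_ideal (3 * m)
    (core_sets (3 * m) m 3 \<union> (\<lambda>k. {k, m + k, 2 * m + k}) ` {1..i}) :: ('k::field) mpoly set) 3"
  using i
proof (induction i)
  case 0
  have "card ({1, 2, 3} \<inter> {1..m}) \<ge> card {1, 2::nat}" using m by (intro card_mono) auto
  then have "{1, 2, 3} \<in> core_sets (3 * m) m 3" using m by (simp add: core_sets_def)
  then show ?case using has_reg_core_sets[OF refl, of "3 * m" m 3] by auto
next
  case (Suc i)
  let ?n = "3 * m"
  define t where "t k = {k, m + k, 2 * m + k}" for k
  let ?F = "core_sets ?n m 3 \<union> t ` {1..i}" and ?u = "t (Suc i)" and ?Z = "{1..m} - {Suc i}"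
  have u: "?u \<subseteq> {1..?n}" "card ?u = 3" using Suc.prems m by (auto simp: t_def)
  have IH: "has_reg ?n (sq_ideal ?n ?F :: 'k mpoly set) 3"
    using Suc.IH Suc.prems by (simp add: t_def)
  have "sq_set ?n ((\<lambda>w. w - ?u) ` ?F) = sq_set ?n ((\<lambda>k. {k}) ` ?Z)"
  proof (rule sq_set_eqI)
    fix v assume "v \<in> (\<lambda>w. w - ?u) ` ?F"
    then obtain w where w: "w \<in> ?F" "v = w - ?u" by blast
    have "\<exists>j\<in>?Z. j \<in> w"
    proof (cases "w \<in> core_sets ?n m 3")
      case True
      then have c: "2 \<le> card (w \<inter> {1..m})" by (simp add: core_sets_def)
      have "\<not> w \<inter> {1..m} \<subseteq> {Suc i}"
      proof
        assume "w \<inter> {1..m} \<subseteq> {Suc i}"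
        then have "card (w \<inter> {1..m}) \<le> card {Suc i}" by (intro card_mono) auto
        then show False using c by simp
      qed
      then show ?thesis by blast
    next
      case False
      then obtain k where "k \<in> {1..i}" "w = t k" using w(1) by blast
      then show ?thesis using Suc.prems by (intro bexI[of _ k]) (auto simp: t_def)
    qed
    then obtain j where "j \<in> ?Z" "j \<in> w" by blast
    moreover have "j \<notin> ?u" using \<open>j \<in> ?Z\<close> by (auto simp: t_def)
    ultimately show "\<exists>z\<in>(\<lambda>k. {k}) ` ?Z. z \<subseteq> v" unfolding w(2) by blast
  next
    fix v assume "v \<in> (\<lambda>k. {k}) ` ?Z"
    then obtain j where j: "v = {j}" "j \<in> {1..m}" "j \<noteq> Suc i" by blast
    let ?w = "{Suc i, j, m + Suc i}"
    have "card {Suc i, j} \<le> card (?w \<inter> {1..m})" using j Suc.prems by (intro card_mono) auto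
    then have "2 \<le> card (?w \<inter> {1..m})" using j(3) by simp
    moreover have "card ?w = 3" "?w \<subseteq> {1..?n}" using j Suc.prems by simp_all
    ultimately have "?w \<in> core_sets ?n m 3" by (simp add: core_sets_def)
    then have "?w - ?u \<in> (\<lambda>w. w - ?u) ` ?F" by blast
    moreover have "?w - ?u \<subseteq> v" by (auto simp: t_def j(1))
    ultimately show "\<exists>w\<in>(\<lambda>w. w - ?u) ` ?F. w \<subseteq> v" by blast
  qed
  moreover have "has_reg ?n (sq_ideal ?n ((\<lambda>k. {k}) ` ?Z) :: 'k mpoly set) 1"
  proof (rule has_reg_variables)
    \<comment> \<open>some core index other than \<open>i + 1\<close>\<close>
    have "(if i = 0 then 2 else 1) \<in> ?Z" using m by auto
    then show "?Z \<noteq> {}" by blast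
  qed auto
  ultimately have "has_reg ?n (sq_ideal ?n (insert ?u ?F) :: 'k mpoly set) (int (card ?u) + 1 - 1)"
    by (intro has_reg_insert[OF u(1) _ _ _ IH]) (simp_all add: u(2))
  moreover have "insert ?u ?F = core_sets ?n m 3 \<union> t ` {1..Suc i}"
    by (simp add: atLeastAtMostSuc_conv)
  ultimately have "has_reg ?n (sq_ideal ?n (core_sets ?n m 3 \<union> t ` {1..Suc i}) :: 'k mpoly set) 3"
    by (simp add: u(2))
  then show ?case by (simp add: t_def)
qed

text \<open>
  When the edge \<open>{m + k, 2m + k}\<close> with \<open>k = i + 1\<close> is added, the colon ideal is generated by the core
  variables, which are neighbours of \<open>m + k\<close>, and by the previous \<open>i\<close> edges. These have
  disjoint supports, so its regularity is \<open>i + 1\<close> and that of the sum is \<open>i + 2\<close>. The maximum accounts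
  for \<open>i = 0\<close>, where the regularity is already \<open>2\<close>.
\<close>

lemma has_reg_pairs:
  assumes m: "1 \<le> m" and i: "i \<le> m"
  shows "has_reg (3 * m) (sq_ideal (3 * m)
    (core_sets (3 * m) m 2 \<union> (\<lambda>k. {m + k, 2 * m + k}) ` {1..i}) :: ('k::field) mpoly set)
    (int (max 1 i) + 1)"
  using i
proof (induction i)
  case 0
  have "{1, 2} \<in> core_sets (3 * m) m 2" using m by (auto simp: in_core_sets_2)
  then show ?case using has_reg_core_sets[OF refl, of "3 * m" m 2] by auto
next
  case (Suc i)
  let ?n = "3 * m"
  define e where "e k = {m + k, 2 * m + k}" for k
  let ?F = "core_sets ?n m 2 \<union> e ` {1..i}" and ?u = "e (Suc i)"
  let ?C = "(\<lambda>k. {k}) ` {1..m} \<union> e ` {1..i}"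
  have u: "?u \<subseteq> {1..?n}" "card ?u = 2" using Suc.prems m by (auto simp: e_def)
  have IH: "has_reg ?n (sq_ideal ?n ?F :: 'k mpoly set) (int (max 1 i) + 1)"
    using Suc.IH Suc.prems by (simp add: e_def)
  have e_diff: "e k - ?u = e k" if "k \<in> {1..i}" for k using that Suc.prems by (auto simp: e_def)
  have "sq_set ?n ((\<lambda>w. w - ?u) ` ?F) = sq_set ?n ?C"
  proof (rule sq_set_eqI)
    fix v assume "v \<in> (\<lambda>w. w - ?u) ` ?F"
    then obtain w where w: "w \<in> ?F" "v = w - ?u" by blast
    show "\<exists>z\<in>?C. z \<subseteq> v"
    proof (cases "w \<in> core_sets ?n m 2")
      case True
      then obtain j where "j \<in> {1..m}" "j \<in> w" by (auto simp: in_core_sets_2)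
      then show ?thesis by (intro bexI[of _ "{j}"]) (auto simp: w(2) e_def)
    next
      case False
      then obtain k where "k \<in> {1..i}" "w = e k" using w(1) by blast
      then show ?thesis using e_diff[of k] w(2) by blast
    qed
  next
    fix v assume "v \<in> ?C"
    then show "\<exists>w\<in>(\<lambda>w. w - ?u) ` ?F. w \<subseteq> v"
    proof
      assume "v \<in> (\<lambda>k. {k}) ` {1..m}"
      then obtain j where j: "v = {j}" "j \<in> {1..m}" by blast
      then have "{j, m + Suc i} \<in> core_sets ?n m 2" using Suc.prems by (auto simp: in_core_sets_2)
      then show ?thesis by (intro bexI[of _ "{j, m + Suc i} - ?u"]) (auto simp: e_def j(1))
    next
      assume "v \<in> e ` {1..i}"
      then show ?thesis using e_diff by blast
    qed
  qed
  moreover have "has_reg ?n (sq_ideal ?n ?C :: 'k mpoly set) (int i + 1)"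
  proof -
    have disj: "(\<lambda>k. {k}) ` {1..m} \<inter> e ` {1..i} = {}" by (auto simp: e_def)
    have inj: "inj_on e {1..i}" by (auto simp: inj_on_def e_def doubleton_eq_iff)
    have "has_reg ?n (sq_ideal ?n ?C :: 'k mpoly set) (1 + (\<Sum>w\<in>?C. int (card w) - 1))"
      using m Suc.prems by (intro has_reg_disjoint) (auto simp: e_def pairwise_def disjnt_def)
    moreover have "(\<Sum>w\<in>?C. int (card w) - 1) =
        (\<Sum>w\<in>(\<lambda>k. {k}) ` {1..m}. int (card w) - 1) + (\<Sum>w\<in>e ` {1..i}. int (card w) - 1)"
      using disj by (intro sum.union_disjoint) auto
    moreover have "(\<Sum>w\<in>(\<lambda>k. {k}) ` {1..m}. int (card w) - 1) = 0" by (intro sum.neutral) auto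
    moreover have "(\<Sum>w\<in>e ` {1..i}. int (card w) - 1) = (\<Sum>k\<in>{1..i}. 1)"
      unfolding sum.reindex[OF inj] o_def using m by (intro sum.cong) (simp_all add: e_def)
    ultimately show ?thesis by (simp add: add.commute)
  qed
  ultimately have "has_reg ?n (sq_ideal ?n (insert ?u ?F) :: 'k mpoly set) (int (card ?u) + (int i + 1) - 1)"
    by (intro has_reg_insert[OF u(1) _ _ _ IH]) (simp_all add: u(2))
  moreover have "insert ?u ?F = core_sets ?n m 2 \<union> e ` {1..Suc i}"
    by (simp add: atLeastAtMostSuc_conv)
  moreover have "int (card ?u) + (int i + 1) - 1 = int (max 1 (Suc i)) + 1" by (simp add: u(2))
  ultimately show ?case by (simp add: e_def)
qed

text \<open>
  The deletions of the cubic generators are exactly the edges of the graph: a pair that meets the core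
  extends to a triple with two core elements, and a pair of outer vertices arises only by deleting the
  core element of some \<open>{k, m + k, 2m + k}\<close>.
\<close>

lemma nonpositive_differences:
  assumes m: "2 \<le> m"
  shows "\<exists>(n::nat) (I :: ('k::field) mpoly set). n > 0 \<and> monomial_ideal n I \<and> char_suitable n I \<and>
    I \<noteq> {0} \<and> gradient_ideal n I \<noteq> {0} \<and> regularity n I - regularity n (gradient_ideal n I) = 2 - int m"
proof -
  let ?n = "3 * m"
  define t where "t k = {k, m + k, 2 * m + k}" for k
  define e where "e k = {m + k, 2 * m + k}" for k
  let ?F = "core_sets ?n m 3 \<union> t ` {1..m}" and ?E = "core_sets ?n m 2 \<union> e ` {1..m}"
  have "card (t k) = 3" if "k \<in> {1..m}" for k using that m by (simp add: t_def)
  then have F: "uniform ?n 3 ?F"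
    unfolding uniform_def by (auto simp: core_sets_def t_def)
  have r: "has_reg ?n (sq_ideal ?n ?F :: 'k mpoly set) 3"
    using has_reg_triples[OF m order_refl] by (simp add: t_def)
  have "has_reg ?n (sq_ideal ?n ?E :: 'k mpoly set) (int (max 1 m) + 1)"
    using has_reg_pairs[OF _ order_refl, of m] m by (simp add: e_def)
  then have "has_reg ?n (sq_ideal ?n ?E :: 'k mpoly set) (int m + 1)" using m by (simp add: max_def)
  moreover have "deletions ?F = ?E"
  proof
    show "deletions ?F \<subseteq> ?E"
    proof
      fix x assume "x \<in> deletions ?F"
      then obtain w v where x: "x = w - {v}" and w: "w \<in> ?F" and v: "v \<in> w" unfolding deletions_def by blast
      have wn: "w \<subseteq> {1..?n}" "card w = 3" "finite w" using uniformD[OF F w] .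
      then have xn: "x \<subseteq> {1..?n}" "card x = 2" unfolding x using v by auto
      show "x \<in> ?E"
      proof (cases "x \<inter> {1..m} = {}")
        case False
        then show ?thesis using xn by (auto simp: in_core_sets_2)
      next
        case True
        then have sub: "w \<inter> {1..m} \<subseteq> {v}" unfolding x by blast
        then have "card (w \<inter> {1..m}) \<le> card {v}" by (rule card_mono[rotated]) simp
        then have "w \<notin> core_sets ?n m 3" by (simp add: core_sets_def)
        then obtain k where k: "k \<in> {1..m}" "w = t k" using w by blast
        have "k \<in> w \<inter> {1..m}" using k by (simp add: t_def)
        then have "v = k" using sub by blast
        moreover have "t k - {k} = e k" using m by (auto simp: t_def e_def)
        ultimately have "x = e k" unfolding x k(2) by simp
        then show ?thesis using k(1) by blast
      qed
    qed
    show "?E \<subseteq> deletions ?F"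
    proof
      fix x assume "x \<in> ?E"
      then show "x \<in> deletions ?F"
      proof
        assume "x \<in> e ` {1..m}"
        then obtain k where k: "k \<in> {1..m}" "x = e k" by blast
        have "e k = t k - {k}" "k \<in> t k" using m by (auto simp: t_def e_def)
        then show ?thesis using k unfolding deletions_def by blast
      next
        assume "x \<in> core_sets ?n m 2"
        then obtain j where x: "x \<subseteq> {1..?n}" "card x = 2" and j: "j \<in> x" "j \<in> {1..m}"
          by (auto simp: in_core_sets_2)
        obtain p q where "x = {p, q}" "p \<noteq> q" using x(2) unfolding card_2_iff by blast
        then obtain l where l: "x = {j, l}" "l \<noteq> j" using j(1) by blast
        \<comment> \<open>add an outer vertex to two core elements, and a second core element otherwise\<close>
        have "\<exists>v\<in>{1..?n}. v \<notin> x \<and> 2 \<le> card (insert v x \<inter> {1..m})"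
        proof (cases "l \<le> m")
          case True
          have "l \<in> {1..m}" using True x(1) l(1) by auto
          then have "card {j, l} \<le> card (insert ?n x \<inter> {1..m})"
            using j l by (intro card_mono) auto
          moreover have "?n \<notin> x" using True j l m by auto
          ultimately show ?thesis using l m by (intro bexI[of _ ?n]) auto
        next
          case False
          define v where "v = (if j = 1 then 2 else 1::nat)"
          have v: "v \<in> {1..m}" "v \<noteq> j" using m by (auto simp: v_def)
          have "card {j, v} \<le> card (insert v x \<inter> {1..m})"
            using j v by (intro card_mono) auto
          then show ?thesis using v False l by (intro bexI[of _ v]) auto
        qed
        then obtain v where v: "v \<in> {1..?n}" "v \<notin> x" "2 \<le> card (insert v x \<inter> {1..m})" by blast
        have "finite x" using x(1) finite_subset by blast
        then have "insert v x \<in> core_sets ?n m 3" using v x by (simp add: core_sets_def)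
        moreover have "x = insert v x - {v}" using v(2) by blast
        ultimately show ?thesis unfolding deletions_def by blast
      qed
    qed
  qed
  ultimately have s: "has_reg ?n (sq_ideal ?n (deletions ?F) :: 'k mpoly set) (int m + 1)" by simp
  have "t 1 \<in> ?F" using m by auto
  then have "?F \<noteq> {}" by blast
  from regularity_difference_witness[OF F _ this _ r s] m show ?thesis by simp
qed

theorem theorem2p2:
  fixes a :: int
  shows "\<exists>(n::nat) (I :: ('k::field) mpoly set).
           n > 0 \<and> monomial_ideal n I \<and> char_suitable n I \<and>
           I \<noteq> {0} \<and> gradient_ideal n I \<noteq> {0} \<and>
           regularity n I - regularity n (gradient_ideal n I) = a"
proof (cases "0 < a")
  case True
  then show ?thesis using positive_differences[of "nat a", where ?'k = 'k] by simp
next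
  case False
  then have "2 \<le> nat (2 - a)" "2 - int (nat (2 - a)) = a" by simp_all
  then show ?thesis using nonpositive_differences[of "nat (2 - a)", where ?'k = 'k] by simp
qed

end
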